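(* Let $\bar d=(d_r)_{r\ge 1}$ be a sequence of integers with $d_r\ge 2$ for all $r\ge1$, and let $\bar p=(p_r)_{r\ge1}$ be a sequence with $p_r\in(0,1]$ for all $r\ge 1$. Assume that the sequence $\bar d$ is bounded. Then $$\sigma\big(\tilde S_{\bar d,\bar p},\mathcal C(\overline{\Gamma_{\bar d}})\big)=\sigma_{ap}\big(\tilde S_{\bar d,\bar p},\mathcal C(\overline{\Gamma_{\bar d}})\big)=\begin{cases}\mathcal E_{\bar d,\bar p} & \text{if } \prod_{r=1}^{+\infty}p_r=0,\\ \partial\mathcal E_{\bar d,\bar p} & \text{if } \prod_{r=1}^{+\infty}p_r>0.\end{cases}$$ Moreover, the point spectrum satisfies $$\sigma_{pt}\big(\tilde S_{\bar d,\bar p},\mathcal C(\overline{\Gamma_{\bar d}})\big)=\bigcup_{r=1}^{\infty}\tilde f_r^{-1}\{1\}\qquad\text{and}\qquad \overline{\bigcup_{r=1}^{\infty}\tilde f_r^{-1}\{1\}}=\partial\mathcal E_{\bar d,\bar p}.$$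
   Context: State space: $\overline{\Gamma_{\bar d}}=\prod_{r\ge1}\{0,\dots,d_r-1\}$ with the product of discrete topologies (compact, metrizable); points are $x=(a_r(x))_{r\ge1}$. $\mathcal C(\overline{\Gamma_{\bar d}})$ is the Banach space of continuous functions $g:\overline{\Gamma_{\bar d}}\to\mathbb C$ with the supremum norm. Counter: $s_x=\min\{r\ge1: a_r(x)\ne d_r-1\}$, with $s_x=+\infty$ if $x=x_{max}:=(d_r-1)_{r\ge1}$. Successor map $V:\overline{\Gamma_{\bar d}}\to\overline{\Gamma_{\bar d}}$ (addition of $1$ with carry): for $x\neq x_{max}$, $a_r(V(x))=0$ for $r<s_x$, $a_{s_x}(V(x))=a_{s_x}(x)+1$, $a_r(V(x))=a_r(x)$ for $r>s_x$; and $V(x_{max})=(0,0,\dots)$. For $1\le s<s_x$, $T_s(x)$ is the point obtained from $x$ by replacing its first $s$ digits by $0$. Operator $\tilde S_{\bar d,\bar p}:\mathcal C(\overline{\Gamma_{\bar d}})\to\mathcal C(\overline{\Gamma_{\bar d}})$ (a well-defined bounded linear operator): $$(\tilde S_{\bar d,\bar p}g)(x)=(1-p_1)g(x)+\Big(\prod_{r=1}^{s_x}p_r\Big)g(V(x))+\sum_{s=1}^{s_x-1}\Big(\prod_{r=1}^{s}p_r\Big)(1-p_{s+1})\,g(T_s(x)),$$ where the sum is $0$ if $s_x=1$, and for $x=x_{max}$ the product and the sum are infinite (upper limits $+\infty$). Fibered filled Julia set: $f_r(z)=\big(\frac{z-(1-p_r)}{p_r}\big)^{d_r}$, $\tilde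 f_r=f_r\circ\cdots\circ f_1$ for $r\ge1$, and $\mathcal E_{\bar d,\bar p}=\{z\in\mathbb C:\limsup_{r\to\infty}|\tilde f_r(z)|<+\infty\}$; $\partial$ denotes the topological boundary in $\mathbb C$. For a bounded linear operator $S$ on a Banach space $X$: $\sigma(S,X)$ is the spectrum, $\sigma_{pt}(S,X)$ is the set of eigenvalues, and $\sigma_{ap}(S,X)=\{\lambda\in\mathbb C:\inf_{\|x\|=1}\|(S-\lambda I)x\|=0\}$. *)

theory Defs
  imports "HOL-Analysis.Analysis"
begin

text \<open>
  Sequences are indexed by \<open>r \<ge> 1\<close>; the values \<open>d 0\<close> and \<open>p 0\<close> are never used.
  A point is a function on \<open>{1..}\<close> (\<open>undefined\<close> at \<open>0\<close>, as usual for product topologies),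
  and \<open>x r\<close> is its \<open>r\<close>-th digit.
\<close>

definition Gamma_top :: "(nat \<Rightarrow> nat) \<Rightarrow> (nat \<Rightarrow> nat) topology" where
  "Gamma_top d = product_topology (\<lambda>r. discrete_topology {..<d r}) {1..}"

definition Gamma :: "(nat \<Rightarrow> nat) \<Rightarrow> (nat \<Rightarrow> nat) set" where
  "Gamma d = topspace (Gamma_top d)"

text \<open>
  The continuous functions on the state space are represented by their extension by \<open>0\<close>, so that
  distinct elements are distinct functions and the vector space operations are pointwise.
\<close>

definition C_Gamma :: "(nat \<Rightarrow> nat) \<Rightarrow> ((nat \<Rightarrow> nat) \<Rightarrow> complex) set" where
  "C_Gamma d = {g. continuous_map (Gamma_top d) euclidean g \<and> (\<forall>x. x \<notin> Gamma d \<longrightarrow> g x = 0)}"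

definition sup_norm :: "(nat \<Rightarrow> nat) \<Rightarrow> ((nat \<Rightarrow> nat) \<Rightarrow> complex) \<Rightarrow> real" where
  "sup_norm d g = (SUP x\<in>Gamma d. cmod (g x))"

definition x_max :: "(nat \<Rightarrow> nat) \<Rightarrow> nat \<Rightarrow> nat" where
  "x_max d = (\<lambda>r\<in>{1..}. d r - 1)"

definition counter :: "(nat \<Rightarrow> nat) \<Rightarrow> (nat \<Rightarrow> nat) \<Rightarrow> enat" where
  "counter d x = (if x = x_max d then \<infinity> else enat (LEAST r. r \<ge> 1 \<and> x r \<noteq> d r - 1))"

text \<open>For \<open>x = x_max d\<close> the counter is infinite, so every digit of the successor is \<open>0\<close>.\<close>

definition successor :: "(nat \<Rightarrow> nat) \<Rightarrow> (nat \<Rightarrow> nat) \<Rightarrow> nat \<Rightarrow> nat" where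
  "successor d x = (\<lambda>r\<in>{1..}.
     if enat r < counter d x then 0
     else if enat r = counter d x then x r + 1
     else x r)"

definition zero_digits :: "nat \<Rightarrow> (nat \<Rightarrow> nat) \<Rightarrow> nat \<Rightarrow> nat" where
  "zero_digits s x = (\<lambda>r\<in>{1..}. if r \<le> s then 0 else x r)"

text \<open>
  The infinite product is the limit of the partial products, which may be \<open>0\<close>. The library's
  \<^const>\<open>prodinf\<close> is not suitable, since it treats divergence to \<open>0\<close> as non-convergence.
\<close>

definition inf_prod :: "(nat \<Rightarrow> real) \<Rightarrow> real" where
  "inf_prod p = lim (\<lambda>n. \<Prod>r=1..n. p r)"

text \<open>In the infinite case the summation variable is shifted: \<open>s = Suc k\<close> with \<open>k \<ge> 0\<close>.\<close>

definition S_op :: "(nat \<Rightarrow> nat) \<Rightarrow> (nat \<Rightarrow> real) \<Rightarrow>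
    ((nat \<Rightarrow> nat) \<Rightarrow> complex) \<Rightarrow> (nat \<Rightarrow> nat) \<Rightarrow> complex" where
  "S_op d p g = (\<lambda>x. if x \<notin> Gamma d then 0 else
     (case counter d x of
        enat n \<Rightarrow>
          of_real (1 - p 1) * g x
          + of_real (\<Prod>r=1..n. p r) * g (successor d x)
          + (\<Sum>s=1..n-1. of_real ((\<Prod>r=1..s. p r) * (1 - p (s + 1))) * g (zero_digits s x))
      | \<infinity> \<Rightarrow>
          of_real (1 - p 1) * g x
          + of_real (inf_prod p) * g (successor d x)
          + (\<Sum>k. of_real ((\<Prod>r=1..Suc k. p r) * (1 - p (Suc k + 1))) * g (zero_digits (Suc k) x))))"

definition fib_map :: "(nat \<Rightarrow> nat) \<Rightarrow> (nat \<Rightarrow> real) \<Rightarrow> nat \<Rightarrow> complex \<Rightarrow> complex" where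
  "fib_map d p r z = ((z - of_real (1 - p r)) / of_real (p r)) ^ d r"

primrec fib_iter :: "(nat \<Rightarrow> nat) \<Rightarrow> (nat \<Rightarrow> real) \<Rightarrow> nat \<Rightarrow> complex \<Rightarrow> complex" where
  "fib_iter d p 0 z = z"
| "fib_iter d p (Suc r) z = fib_map d p (Suc r) (fib_iter d p r z)"

definition filled_julia :: "(nat \<Rightarrow> nat) \<Rightarrow> (nat \<Rightarrow> real) \<Rightarrow> complex set" where
  "filled_julia d p = {z. limsup (\<lambda>r. ereal (cmod (fib_iter d p r z))) < \<infinity>}"

text \<open>
  Spectra of an operator \<open>S\<close> on a Banach space of complex-valued functions with carrier \<open>X\<close>
  and norm \<open>N\<close>.
\<close>

definition bounded_operator_on ::
    "('a \<Rightarrow> complex) set \<Rightarrow> (('a \<Rightarrow> complex) \<Rightarrow> real) \<Rightarrow> (('a \<Rightarrow> complex) \<Rightarrow> 'a \<Rightarrow> complex) \<Rightarrow> bool" where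
  "bounded_operator_on X N T \<longleftrightarrow>
     (\<forall>g\<in>X. T g \<in> X) \<and>
     (\<forall>g\<in>X. \<forall>h\<in>X. T (\<lambda>x. g x + h x) = (\<lambda>x. T g x + T h x)) \<and>
     (\<forall>c. \<forall>g\<in>X. T (\<lambda>x. c * g x) = (\<lambda>x. c * T g x)) \<and>
     (\<exists>K. \<forall>g\<in>X. N (T g) \<le> K * N g)"

definition shifted ::
    "(('a \<Rightarrow> complex) \<Rightarrow> 'a \<Rightarrow> complex) \<Rightarrow> complex \<Rightarrow> ('a \<Rightarrow> complex) \<Rightarrow> 'a \<Rightarrow> complex" where
  "shifted S l g = (\<lambda>x. S g x - l * g x)"

definition spectrum_on ::
    "('a \<Rightarrow> complex) set \<Rightarrow> (('a \<Rightarrow> complex) \<Rightarrow> real) \<Rightarrow> (('a \<Rightarrow> complex) \<Rightarrow> 'a \<Rightarrow> complex) \<Rightarrow> complex set" where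
  "spectrum_on X N S = {l. \<not> (\<exists>R. bounded_operator_on X N R \<and>
     (\<forall>g\<in>X. R (shifted S l g) = g \<and> shifted S l (R g) = g))}"

definition point_spectrum_on ::
    "('a \<Rightarrow> complex) set \<Rightarrow> (('a \<Rightarrow> complex) \<Rightarrow> 'a \<Rightarrow> complex) \<Rightarrow> complex set" where
  "point_spectrum_on X S = {l. \<exists>g\<in>X. g \<noteq> (\<lambda>x. 0) \<and> S g = (\<lambda>x. l * g x)}"

definition approx_spectrum_on ::
    "('a \<Rightarrow> complex) set \<Rightarrow> (('a \<Rightarrow> complex) \<Rightarrow> real) \<Rightarrow> (('a \<Rightarrow> complex) \<Rightarrow> 'a \<Rightarrow> complex) \<Rightarrow> complex set" where
  "approx_spectrum_on X N S = {l. (INF g\<in>{g\<in>X. N g = 1}. N (shifted S l g)) = 0}"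

end

(*
  A point x of the state space is its first digit followed by a point of the state space of the
  shifted parameters, and (S - (1 - p_1)) / p_1 increments the first digit or, on a carry, applies
  the operator S' of the shifted parameters. So its d_1-th power is S' on every fibre: l is an
  eigenvalue, or a point of the resolvent set, of S as soon as f_1(l) is one of S'. Iterating,
  everything about l is read off from w_r = fib_iter d p r l and the r-th shifted operator. If some
  |w_r| > 1, the latter minus w_r is invertible because it is a contraction. If the infinite product
  is positive, the shifted operators approach the isometric composition with the odometer and l in
  the interior of the Julia set has |w_r| < 3/4 for arbitrarily large r, so again the difference
  is invertible. The product of the powers iota_r^(x_r), r <= m, is an eigenfunction up to an error
  p_1 ... p_m |w_m - 1|, which is 0 if w_m = 1 and tends to 0 on the Julia set if the infinite
  product vanishes.
*)

theory Submission
  imports Defs "HOL-Complex_Analysis.Complex_Analysis"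
begin

section \<open>The state space\<close>

text \<open>The converse for eigenvalues rests on continuity. After m passages to the fibre of digit
  0, an eigenfunction normalised at the zero sequence varies by at most 1/4; the same holds after
  every further passage, and each time all iota^a with a < d_1 are close to 1. Since 1 is a
  repelling fixed point of every f_r, with a factor bounded away from 1, w_m can only be 1 itself.
  The number 3/4 has to meet two demands. An orbit that never enters the disc of radius 3/4 has
  derivatives growing at least like (3/2)^r, where 3/2 is twice 3/4, and an interior point of the
  Julia set does not allow this. And 3/4 leaves 1/4 for the distance 2 (1 - P) to the odometer,
  where P is a tail of the infinite product; hence P > 7/8 is required. The p_r may come arbitrarily
  close to 0, so the estimates have to be uniform in r: in the expansion estimates the factor 1/p_r
  can only help, and in the argument with Schottky's theorem it is avoided by looking one iterate
  further.\<close>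

definition params :: "(nat \<Rightarrow> nat) \<Rightarrow> (nat \<Rightarrow> real) \<Rightarrow> bool" where
  "params d p \<longleftrightarrow> (\<forall>r\<ge>1. 2 \<le> d r \<and> 0 < p r \<and> p r \<le> 1)"

definition shift :: "(nat \<Rightarrow> 'a) \<Rightarrow> nat \<Rightarrow> 'a" where
  "shift f = (\<lambda>n. f (Suc n))"

definition cons_digit :: "nat \<Rightarrow> (nat \<Rightarrow> nat) \<Rightarrow> nat \<Rightarrow> nat" where
  "cons_digit a y = (\<lambda>r\<in>{1..}. if r = 1 then a else y (r - 1))"

definition tail_digits :: "(nat \<Rightarrow> nat) \<Rightarrow> nat \<Rightarrow> nat" where
  "tail_digits x = (\<lambda>r\<in>{1..}. x (Suc r))"

definition agree :: "nat \<Rightarrow> (nat \<Rightarrow> nat) \<Rightarrow> (nat \<Rightarrow> nat) \<Rightarrow> bool" where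
  "agree m x y \<longleftrightarrow> (\<forall>r\<in>{1..m}. x r = y r)"

definition zeros :: "nat \<Rightarrow> nat" where
  "zeros = (\<lambda>r\<in>{1..}. 0)"

lemma shift_apply [simp]: "shift f n = f (Suc n)"
  by (simp add: shift_def)

lemma params_shift: "params d p \<Longrightarrow> params (shift d) (shift p)"
  by (simp add: params_def)

lemma paramsD:
  assumes "params d p" "r \<ge> 1"
  shows "d r \<ge> 2" "p r > 0" "p r \<le> 1"
  using assms by (auto simp: params_def)

lemma params_1:
  assumes "params d p"
  shows "d 1 \<ge> 2" "p 1 > 0" "p 1 \<le> 1" "d (Suc 0) \<ge> 2" "p (Suc 0) > 0" "p (Suc 0) \<le> 1"
  using assms by (auto simp: params_def)

lemma Gamma_eq: "Gamma d = (\<Pi>\<^sub>E r\<in>{1..}. {..<d r})"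
  by (simp add: Gamma_def Gamma_top_def)

lemma Gamma_digit: "x \<in> Gamma d \<Longrightarrow> r \<ge> 1 \<Longrightarrow> x r < d r"
  by (auto simp: Gamma_eq PiE_iff)

lemma Gamma_extensional: "x \<in> Gamma d \<Longrightarrow> x \<in> extensional {1..}"
  by (auto simp: Gamma_eq PiE_iff)

lemma GammaI:
  "(\<And>r. r \<ge> 1 \<Longrightarrow> x r < d r) \<Longrightarrow> x \<in> extensional {1..} \<Longrightarrow> x \<in> Gamma d"
  by (auto simp: Gamma_eq PiE_iff)

lemma Gamma_eqI:
  assumes "x \<in> Gamma d" "y \<in> Gamma d" "\<And>r. r \<ge> 1 \<Longrightarrow> x r = y r"
  shows "x = y"
  using assms by (intro extensionalityI[where A = "{1..}"]) (auto dest: Gamma_extensional)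

lemma zeros_in_Gamma: "params d p \<Longrightarrow> zeros \<in> Gamma d"
  by (fastforce intro!: GammaI simp: zeros_def params_def)

lemma Gamma_nonempty: "params d p \<Longrightarrow> Gamma d \<noteq> {}"
  using zeros_in_Gamma by blast

lemma cons_digit_in_Gamma:
  "y \<in> Gamma (shift d) \<Longrightarrow> a < d 1 \<Longrightarrow> cons_digit a y \<in> Gamma d"
proof (rule GammaI)
  fix r :: nat assume y: "y \<in> Gamma (shift d)" "a < d 1" and r: "r \<ge> 1"
  show "cons_digit a y r < d r"
  proof (cases "r = 1")
    case True
    then show ?thesis using y by (simp add: cons_digit_def)
  next
    case False
    then have "r - 1 \<ge> 1" "Suc (r - 1) = r" using r by auto
    then show ?thesis using Gamma_digit[OF y(1), of "r - 1"] r False by (simp add: cons_digit_def)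
  qed
qed (simp add: cons_digit_def)

lemma tail_digits_in_Gamma: "x \<in> Gamma d \<Longrightarrow> tail_digits x \<in> Gamma (shift d)"
  by (rule GammaI) (simp_all add: tail_digits_def Gamma_digit)

lemma tail_cons_digit: "y \<in> Gamma d \<Longrightarrow> tail_digits (cons_digit a y) = y"
  by (rule extensionalityI[where A = "{1..}"])
     (auto simp: tail_digits_def cons_digit_def dest: Gamma_extensional)

lemma cons_tail_digits: "x \<in> Gamma d \<Longrightarrow> cons_digit (x 1) (tail_digits x) = x"
  by (rule extensionalityI[where A = "{1..}"])
     (auto simp: tail_digits_def cons_digit_def dest: Gamma_extensional)

lemma cons_digit_1 [simp]: "cons_digit a y 1 = a" "cons_digit a y (Suc 0) = a"
  by (auto simp: cons_digit_def)

lemma cons_zeros: "cons_digit 0 zeros = zeros"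
  by (auto simp: cons_digit_def zeros_def fun_eq_iff restrict_def)

lemma tail_zeros: "tail_digits zeros = zeros"
  by (auto simp: tail_digits_def zeros_def fun_eq_iff restrict_def)

section \<open>Cylinders and uniform continuity\<close>

lemma agree_mono: "agree n x y \<Longrightarrow> m \<le> n \<Longrightarrow> agree m x y"
  by (auto simp: agree_def)

lemma agree_trans: "agree n x y \<Longrightarrow> agree n y z \<Longrightarrow> agree n x z"
  by (auto simp: agree_def)

lemma agree_cons_digit: "agree m x y \<Longrightarrow> agree (Suc m) (cons_digit a x) (cons_digit a y)"
  unfolding agree_def
proof
  fix r assume xy: "\<forall>r\<in>{1..m}. x r = y r" and r: "r \<in> {1..Suc m}"
  have "x (r - 1) = y (r - 1)" if "r \<noteq> 1"
    by (rule bspec[OF xy]) (use that r in auto)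
  then show "cons_digit a x r = cons_digit a y r" using r by (simp add: cons_digit_def)
qed

lemma agree_tail_digits: "agree (Suc m) x y \<Longrightarrow> agree m (tail_digits x) (tail_digits y)"
  by (auto simp: agree_def tail_digits_def)

lemma agree_Suc_1: "agree (Suc m) x y \<Longrightarrow> x (Suc 0) = y (Suc 0)"
  by (auto simp: agree_def)

text \<open>As a product set, a cylinder restricts only finitely many coordinates.\<close>

lemma openin_cylinder:
  assumes "x \<in> Gamma d"
  shows "openin (Gamma_top d) {y \<in> Gamma d. agree m x y}"
proof -
  have eq: "{y \<in> Gamma d. agree m x y} = (\<Pi>\<^sub>E r\<in>{1..}. if r \<le> m then {x r} else {..<d r})"
  proof (intro set_eqI iffI)
    fix y assume "y \<in> {y \<in> Gamma d. agree m x y}"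
    then show "y \<in> (\<Pi>\<^sub>E r\<in>{1..}. if r \<le> m then {x r} else {..<d r})"
      by (simp add: Gamma_eq agree_def PiE_iff)
  next
    fix y assume y: "y \<in> (\<Pi>\<^sub>E r\<in>{1..}. if r \<le> m then {x r} else {..<d r})"
    then have yr: "y r \<in> (if r \<le> m then {x r} else {..<d r})" if "r \<ge> 1" for r
      using that by (auto simp: PiE_iff)
    have "y r < d r" if "r \<ge> 1" for r
      using yr[OF that] Gamma_digit[OF assms that] by (cases "r \<le> m") auto
    then have "y \<in> Gamma d"
      using y by (intro GammaI) (simp_all add: PiE_iff)
    moreover have "agree m x y"
      unfolding agree_def using yr by fastforce
    ultimately show "y \<in> {y \<in> Gamma d. agree m x y}" by simp
  qed
  have "{r \<in> {1..}. (if r \<le> m then {x r} else {..<d r}) \<noteq> topspace (discrete_topology {..<d r})} \<subseteq> {..m}"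
    by auto
  then have "finite {r \<in> {1..}. (if r \<le> m then {x r} else {..<d r}) \<noteq> topspace (discrete_topology {..<d r})}"
    using finite_subset by blast
  then show ?thesis
    unfolding eq Gamma_top_def using Gamma_digit[OF assms]
    by (subst openin_PiE_gen) auto
qed

lemma compact_Gamma: "compact_space (Gamma_top d)"
  by (simp add: Gamma_top_def compact_space_product_topology compact_space_discrete_topology)

text \<open>By compactness continuity is uniform, and agreement on a prefix takes the place of a
  metric. Later continuity proofs for functions on the state space use this form instead of open
  sets.\<close>

lemma C_Gamma_iff:
  "g \<in> C_Gamma d \<longleftrightarrow> (\<forall>x. x \<notin> Gamma d \<longrightarrow> g x = 0) \<and>
     (\<forall>e>0. \<exists>m. \<forall>x\<in>Gamma d. \<forall>y\<in>Gamma d. agree m x y \<longrightarrow> cmod (g x - g y) \<le> e)"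
    (is "_ \<longleftrightarrow> ?Z \<and> ?U")
proof
  assume g: "g \<in> C_Gamma d"
  have cont: "continuous_map (Gamma_top d) euclidean g"
    using g by (simp add: C_Gamma_def)
  have loc: "\<exists>m. \<forall>y\<in>Gamma d. agree m x y \<longrightarrow> cmod (g y - g x) < e" if "x \<in> Gamma d" "e > 0" for x e
  proof -
    let ?O = "{y \<in> Gamma d. g y \<in> ball (g x) e}"
    have "openin (Gamma_top d) ?O"
      using openin_continuous_map_preimage[OF cont, of "ball (g x) e"] by (simp add: Gamma_def)
    moreover have "x \<in> ?O" using that by simp
    ultimately obtain U where U: "finite {i \<in> {1..}. U i \<noteq> {..<d i}}" "x \<in> Pi\<^sub>E {1..} U" "Pi\<^sub>E {1..} U \<subseteq> ?O"
      unfolding Gamma_top_def openin_product_topology_alt topspace_discrete_topology by meson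
    obtain m where m: "\<And>i. i \<in> {i \<in> {1..}. U i \<noteq> {..<d i}} \<Longrightarrow> i \<le> m"
      using U(1) by (meson finite_nat_set_iff_bounded_le)
    have "y \<in> Pi\<^sub>E {1..} U" if y: "y \<in> Gamma d" "agree m x y" for y
    proof (rule PiE_I)
      fix i :: nat assume i: "i \<in> {1..}"
      show "y i \<in> U i"
      proof (cases "i \<le> m")
        case True
        then have "y i = x i" using y(2) i by (auto simp: agree_def)
        then show ?thesis using U(2) i by auto
      next
        case False
        then have "U i = {..<d i}" using m i by blast
        then show ?thesis using y(1) i by (auto simp: Gamma_digit)
      qed
    next
      fix i :: nat assume "i \<notin> {1..}"
      then show "y i = undefined"
        using Gamma_extensional[OF y(1)] by (auto simp: extensional_def)
    qed
    then have "\<forall>y\<in>Gamma d. agree m x y \<longrightarrow> cmod (g y - g x) < e"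
      using U(3) by (fastforce simp: dist_norm norm_minus_commute)
    then show ?thesis ..
  qed
  have ?U
  proof (intro allI impI)
    fix e :: real assume e: "e > 0"
    then have "\<forall>x\<in>Gamma d. \<exists>m. \<forall>y\<in>Gamma d. agree m x y \<longrightarrow> cmod (g y - g x) < e / 2"
      using loc[OF _ half_gt_zero[OF e]] by blast
    then obtain M where M: "\<And>x y. x \<in> Gamma d \<Longrightarrow> y \<in> Gamma d \<Longrightarrow> agree (M x) x y \<Longrightarrow> cmod (g y - g x) < e / 2"
      by metis
    let ?C = "\<lambda>x. {y \<in> Gamma d. agree (M x) x y}"
    \<comment> \<open>Finitely many of the cylinders of length \<open>M x\<close> cover the space,
      and the largest of their lengths serves all points.\<close>
    have "\<exists>F. finite F \<and> F \<subseteq> ?C ` Gamma d \<and> Gamma d \<subseteq> \<Union>F"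
    proof -
      have "\<forall>U\<in>?C ` Gamma d. openin (Gamma_top d) U" using openin_cylinder by blast
      moreover have "topspace (Gamma_top d) \<subseteq> \<Union> (?C ` Gamma d)"
        by (auto simp: agree_def Gamma_def)
      ultimately show ?thesis
        using compact_Gamma[of d] unfolding compact_space_alt Gamma_def by presburger
    qed
    then obtain F where F: "finite F" "F \<subseteq> ?C ` Gamma d" "Gamma d \<subseteq> \<Union>F" by blast
    obtain A where A: "finite A" "A \<subseteq> Gamma d" "F = ?C ` A"
      using finite_subset_image[OF F(1,2)] by blast
    obtain m where m: "\<And>x. x \<in> A \<Longrightarrow> M x \<le> m"
      using finite_imageI[OF A(1), of M] unfolding finite_nat_set_iff_bounded_le by blast
    have "cmod (g x - g y) \<le> e" if xy: "x \<in> Gamma d" "y \<in> Gamma d" "agree m x y" for x y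
    proof -
      obtain z where z: "z \<in> A" "agree (M z) z x" using F(3) A(3) xy(1) by blast
      then have "agree (M z) z y"
        using agree_trans agree_mono[OF xy(3)] m by blast
      then have "cmod (g x - g z) < e / 2" "cmod (g y - g z) < e / 2"
        using M z A(2) xy by blast+
      then show ?thesis
        using norm_triangle_ineq4[of "g x - g z" "g y - g z"] by simp
    qed
    then show "\<exists>m. \<forall>x\<in>Gamma d. \<forall>y\<in>Gamma d. agree m x y \<longrightarrow> cmod (g x - g y) \<le> e" by blast
  qed
  then show "?Z \<and> ?U" using g by (simp add: C_Gamma_def)
next
  assume ZU: "?Z \<and> ?U"
  have "continuous_map (Gamma_top d) euclidean g"
    unfolding continuous_map_def
  proof (intro conjI allI impI)
    show "g \<in> topspace (Gamma_top d) \<rightarrow> topspace euclidean" by simp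
    fix U :: "complex set" assume U: "openin euclidean U"
    show "openin (Gamma_top d) {x \<in> topspace (Gamma_top d). g x \<in> U}"
    proof (subst openin_subopen, intro ballI)
      fix x assume "x \<in> {x \<in> topspace (Gamma_top d). g x \<in> U}"
      then have x: "x \<in> Gamma d" "g x \<in> U" by (auto simp: Gamma_def)
      have "open U" using U by (simp flip: open_openin)
      then obtain e where e: "e > 0" "cball (g x) e \<subseteq> U" using x open_contains_cball by blast
      obtain m where m: "\<forall>x\<in>Gamma d. \<forall>y\<in>Gamma d. agree m x y \<longrightarrow> cmod (g x - g y) \<le> e"
        using ZU e by blast
      show "\<exists>T. openin (Gamma_top d) T \<and> x \<in> T \<and> T \<subseteq> {x \<in> topspace (Gamma_top d). g x \<in> U}"
        using openin_cylinder[OF x(1), of m] m x e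
        by (intro exI[of _ "{y \<in> Gamma d. agree m x y}"])
           (auto simp: agree_def Gamma_def dist_norm subset_iff)
    qed
  qed
  then show "g \<in> C_Gamma d" using ZU by (simp add: C_Gamma_def)
qed

lemma C_GammaD:
  assumes "g \<in> C_Gamma d"
  shows "x \<notin> Gamma d \<Longrightarrow> g x = 0"
    and "e > 0 \<Longrightarrow> \<exists>m. \<forall>x\<in>Gamma d. \<forall>y\<in>Gamma d. agree m x y \<longrightarrow> cmod (g x - g y) \<le> e"
  using assms unfolding C_Gamma_iff by blast+

lemma C_Gamma_eqI:
  assumes "g \<in> C_Gamma d" "h \<in> C_Gamma d" "\<And>x. x \<in> Gamma d \<Longrightarrow> g x = h x"
  shows "g = h"
  using assms C_GammaD(1) by (metis ext)

section \<open>The supremum norm\<close>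

lemma C_Gamma_bounded:
  assumes "g \<in> C_Gamma d"
  shows "\<exists>B. \<forall>x\<in>Gamma d. cmod (g x) \<le> B"
proof -
  have "compactin (Gamma_top d) (Gamma d)"
    using compact_Gamma by (simp add: compact_space_def Gamma_def)
  then have "compactin euclidean (g ` Gamma d)"
    using assms image_compactin by (fastforce simp: C_Gamma_def)
  then have "bounded (g ` Gamma d)" by (simp add: compact_imp_bounded)
  then show ?thesis by (auto simp: bounded_iff)
qed

lemma cmod_le_sup_norm:
  assumes "g \<in> C_Gamma d" "x \<in> Gamma d"
  shows "cmod (g x) \<le> sup_norm d g"
proof -
  obtain B where "\<forall>x\<in>Gamma d. cmod (g x) \<le> B" using C_Gamma_bounded[OF assms(1)] by blast
  then have "bdd_above ((\<lambda>x. cmod (g x)) ` Gamma d)" by (intro bdd_aboveI2[of _ _ B]) blast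
  then show ?thesis unfolding sup_norm_def by (rule cSUP_upper[OF assms(2)])
qed

lemma sup_norm_le:
  assumes "Gamma d \<noteq> {}" "\<And>x. x \<in> Gamma d \<Longrightarrow> cmod (g x) \<le> B"
  shows "sup_norm d g \<le> B"
  unfolding sup_norm_def using assms by (intro cSUP_least) auto

lemma sup_norm_nonneg:
  assumes "Gamma d \<noteq> {}" "g \<in> C_Gamma d"
  shows "0 \<le> sup_norm d g"
  using assms cmod_le_sup_norm by (meson ex_in_conv norm_ge_zero order_trans)

lemma sup_norm_eq_0:
  assumes "g \<in> C_Gamma d" "sup_norm d g \<le> 0"
  shows "g = (\<lambda>x. 0)"
proof
  fix x show "g x = 0"
    using assms(2) cmod_le_sup_norm[OF assms(1), of x] C_GammaD(1)[OF assms(1), of x]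
    by (metis norm_le_zero_iff order_trans)
qed

lemma sup_norm_pos:
  assumes "Gamma d \<noteq> {}" "g \<in> C_Gamma d" "g \<noteq> (\<lambda>x. 0)"
  shows "0 < sup_norm d g"
  using sup_norm_nonneg[OF assms(1,2)] sup_norm_eq_0[OF assms(2)] assms(3) by fastforce

lemma sup_norm_cmult:
  assumes "Gamma d \<noteq> {}" "g \<in> C_Gamma d"
  shows "sup_norm d (\<lambda>x. c * g x) = cmod c * sup_norm d g"
proof (cases "c = 0")
  case True
  then show ?thesis using assms by (simp add: sup_norm_def)
next
  case False
  show ?thesis
  proof (rule antisym)
    show "sup_norm d (\<lambda>x. c * g x) \<le> cmod c * sup_norm d g"
      using assms by (intro sup_norm_le) (auto simp: norm_mult intro!: mult_left_mono cmod_le_sup_norm)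
    obtain B where B: "\<forall>x\<in>Gamma d. cmod (g x) \<le> B" using C_Gamma_bounded assms by blast
    have "cmod (g x) \<le> sup_norm d (\<lambda>x. c * g x) / cmod c" if "x \<in> Gamma d" for x
    proof -
      have "cmod (c * g x) \<le> sup_norm d (\<lambda>x. c * g x)"
        unfolding sup_norm_def
        by (rule cSUP_upper[OF that], rule bdd_aboveI2[of _ _ "cmod c * B"])
           (use B in \<open>auto simp: norm_mult intro!: mult_left_mono\<close>)
      then show ?thesis using False by (simp add: norm_mult field_simps)
    qed
    then have "sup_norm d g \<le> sup_norm d (\<lambda>x. c * g x) / cmod c"
      using assms by (intro sup_norm_le) auto
    then show "cmod c * sup_norm d g \<le> sup_norm d (\<lambda>x. c * g x)"
      using False by (simp add: field_simps)
  qed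
qed

section \<open>Vector space operations and completeness\<close>

lemma C_Gamma_cmult: "g \<in> C_Gamma d \<Longrightarrow> (\<lambda>x. c * g x) \<in> C_Gamma d"
  using continuous_map_compose[of "Gamma_top d" euclidean g euclidean "\<lambda>z. c * z"]
  by (auto simp: C_Gamma_def o_def intro!: continuous_intros)

lemma C_Gamma_add: "g \<in> C_Gamma d \<Longrightarrow> h \<in> C_Gamma d \<Longrightarrow> (\<lambda>x. g x + h x) \<in> C_Gamma d"
  by (auto simp: C_Gamma_def intro!: continuous_map_add)

lemma C_Gamma_diff: "g \<in> C_Gamma d \<Longrightarrow> h \<in> C_Gamma d \<Longrightarrow> (\<lambda>x. g x - h x) \<in> C_Gamma d"
  by (auto simp: C_Gamma_def intro!: continuous_map_diff)

lemma C_Gamma_zero: "(\<lambda>x. 0) \<in> C_Gamma d"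
  by (simp add: C_Gamma_def)

lemma C_Gamma_const: "(\<lambda>x. if x \<in> Gamma d then c else 0) \<in> C_Gamma d"
  by (auto simp: C_Gamma_iff)

lemma C_Gamma_uniform_limit:
  assumes "\<And>e. e > 0 \<Longrightarrow> \<exists>h\<in>C_Gamma d. \<forall>x\<in>Gamma d. cmod (g x - h x) \<le> e"
    and "\<And>x. x \<notin> Gamma d \<Longrightarrow> g x = 0"
  shows "g \<in> C_Gamma d"
  unfolding C_Gamma_iff
proof (intro conjI allI impI)
  fix e :: real assume e: "e > 0"
  then obtain h where h: "h \<in> C_Gamma d" "\<forall>x\<in>Gamma d. cmod (g x - h x) \<le> e / 3"
    using assms(1)[of "e / 3"] by auto
  obtain m where m: "\<forall>x\<in>Gamma d. \<forall>y\<in>Gamma d. agree m x y \<longrightarrow> cmod (h x - h y) \<le> e / 3"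
    using C_GammaD(2)[OF h(1), of "e / 3"] e by auto
  have "cmod (g x - g y) \<le> e" if "x \<in> Gamma d" "y \<in> Gamma d" "agree m x y" for x y
  proof -
    have "g x - g y = (g x - h x) + (h x - h y) - (g y - h y)" by simp
    then have "cmod (g x - g y) \<le> cmod (g x - h x) + cmod (h x - h y) + cmod (g y - h y)"
      by (metis norm_triangle_ineq norm_triangle_ineq4 add_right_mono order_trans)
    moreover have "cmod (g x - h x) \<le> e / 3" "cmod (g y - h y) \<le> e / 3" "cmod (h x - h y) \<le> e / 3"
      using h(2) m that by blast+
    ultimately show ?thesis by linarith
  qed
  then show "\<exists>m. \<forall>x\<in>Gamma d. \<forall>y\<in>Gamma d. agree m x y \<longrightarrow> cmod (g x - g y) \<le> e" by blast
qed (use assms(2) in auto)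

text \<open>Banach's fixed point theorem, which later provides the solutions of (S - l) g = y. The
  hypothesis speaks of pointwise bounds \<open>B\<close> instead of \<open>sup_norm\<close>, so the
  iteration handles no suprema; the pointwise limit is continuous because the geometric tail bound
  is uniform.\<close>

lemma contraction_fixpoint:
  assumes F: "\<And>g. g \<in> C_Gamma d \<Longrightarrow> F g \<in> C_Gamma d"
    and c: "0 \<le> c" "c < 1"
    and contr: "\<And>g h B. \<lbrakk>g \<in> C_Gamma d; h \<in> C_Gamma d; \<And>x. x \<in> Gamma d \<Longrightarrow> cmod (g x - h x) \<le> B\<rbrakk>
      \<Longrightarrow> \<forall>x\<in>Gamma d. cmod (F g x - F h x) \<le> c * B"
  shows "\<exists>g\<in>C_Gamma d. F g = g"
proof -
  define G where "G n = (F ^^ n) (\<lambda>x. 0)" for n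
  have G: "G n \<in> C_Gamma d" for n
    by (induction n) (auto simp: G_def C_Gamma_zero F)
  have GS: "G (Suc n) = F (G n)" for n by (simp add: G_def)
  obtain B0 where B0: "\<forall>x\<in>Gamma d. cmod (G 1 x) \<le> B0" using C_Gamma_bounded[OF G] by blast
  \<comment> \<open>\<open>Gamma d\<close> may be empty here, so \<open>B0\<close> may be negative,
    but the geometric estimates multiply by \<open>B\<close>.\<close>
  define B where "B = max B0 0"
  have B: "B \<ge> 0" "\<forall>x\<in>Gamma d. cmod (G 1 x) \<le> B" using B0 by (force simp: B_def)+
  have step: "\<forall>x\<in>Gamma d. cmod (G (Suc n) x - G n x) \<le> c ^ n * B" for n
  proof (induction n)
    case 0
    then show ?case using B by (simp add: G_def)
  next
    case (Suc n)
    then show ?case using contr[OF G G, of "Suc n" n "c ^ n * B"] by (simp add: GS mult.assoc)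
  qed
  have far: "cmod (G (n + k) x - G n x) \<le> c ^ n * B / (1 - c)" if "x \<in> Gamma d" for n k x
  proof -
    have "cmod (G (n + k) x - G n x) \<le> (\<Sum>i<k. c ^ (n + i) * B)"
    proof (induction k)
      case (Suc k)
      have "cmod (G (n + Suc k) x - G n x) \<le> cmod (G (Suc (n + k)) x - G (n + k) x) + cmod (G (n + k) x - G n x)"
        by (metis add_Suc_right diff_add_cancel add_diff_eq norm_triangle_ineq)
      then show ?case using Suc step[of "n + k"] that by fastforce
    qed simp
    also have "\<dots> = c ^ n * B * (\<Sum>i<k. c ^ i)"
      by (simp add: sum_distrib_left power_add mult_ac)
    also have "\<dots> \<le> c ^ n * B * (1 / (1 - c))"
    proof (rule mult_left_mono)
      show "(\<Sum>i<k. c ^ i) \<le> 1 / (1 - c)"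
        using c sum_le_suminf[of "\<lambda>i. c ^ i" "{..<k}"] by (simp add: suminf_geometric summable_geometric)
    qed (use c B in auto)
    finally show ?thesis by simp
  qed
  have lim0: "(\<lambda>n. c ^ n * B / (1 - c)) \<longlonglongrightarrow> 0"
    using c by (auto intro!: tendsto_eq_intros LIMSEQ_realpow_zero)
  have "Cauchy (\<lambda>n. G n x)" if x: "x \<in> Gamma d" for x
  proof (rule metric_CauchyI)
    fix e :: real assume "e > 0"
    then obtain N where N: "c ^ N * B / (1 - c) < e / 2"
      using order_tendstoD(2)[OF lim0, of "e / 2"] by (auto simp: eventually_sequentially)
    have "dist (G m x) (G n x) < e" if "m \<ge> N" "n \<ge> N" for m n
    proof -
      have "dist (G m x) (G n x) \<le> dist (G m x) (G N x) + dist (G n x) (G N x)"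
        by (rule dist_triangle2)
      then show ?thesis
        using far[OF x, of N "m - N"] far[OF x, of N "n - N"] N that(1,2) unfolding dist_norm
        by (simp only: le_add_diff_inverse) argo
    qed
    then show "\<exists>N. \<forall>m\<ge>N. \<forall>n\<ge>N. dist (G m x) (G n x) < e" by blast
  qed
  then have "\<forall>x\<in>Gamma d. \<exists>l. (\<lambda>n. G n x) \<longlonglongrightarrow> l"
    by (meson Cauchy_convergent_iff convergent_def)
  then obtain g0 where g0: "\<And>x. x \<in> Gamma d \<Longrightarrow> (\<lambda>n. G n x) \<longlonglongrightarrow> g0 x" by metis
  define g where "g x = (if x \<in> Gamma d then g0 x else 0)" for x
  have near: "cmod (g x - G n x) \<le> c ^ n * B / (1 - c)" if "x \<in> Gamma d" for x n
  proof -
    have "(\<lambda>k. G (n + k) x) \<longlonglongrightarrow> g0 x"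
      using LIMSEQ_ignore_initial_segment[OF g0[OF that], of n] by (simp add: add.commute)
    then have "(\<lambda>k. cmod (G (n + k) x - G n x)) \<longlonglongrightarrow> cmod (g0 x - G n x)"
      by (intro tendsto_intros)
    then show ?thesis using far[OF that] that by (auto intro: LIMSEQ_le_const2 simp: g_def)
  qed
  have g: "g \<in> C_Gamma d"
  proof (rule C_Gamma_uniform_limit)
    fix e :: real assume "e > 0"
    then obtain N where N: "c ^ N * B / (1 - c) < e"
      using order_tendstoD(2)[OF lim0, of e] by (auto simp: eventually_sequentially)
    then have "\<forall>x\<in>Gamma d. cmod (g x - G N x) \<le> e"
      using order_trans[OF near less_imp_le[OF N]] by blast
    then show "\<exists>h\<in>C_Gamma d. \<forall>x\<in>Gamma d. cmod (g x - h x) \<le> e" using G by blast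
  qed (simp add: g_def)
  have "F g = g"
  proof (rule C_Gamma_eqI[OF F[OF g] g])
    fix x assume x: "x \<in> Gamma d"
    have "cmod (F g x - g x) \<le> c * (c ^ n * B / (1 - c)) + c ^ Suc n * B / (1 - c)" for n
    proof -
      have "cmod (F g x - G (Suc n) x) \<le> c * (c ^ n * B / (1 - c))"
        unfolding GS using contr[OF g G near] x by blast
      moreover have "cmod (g x - G (Suc n) x) \<le> c ^ Suc n * B / (1 - c)" using near x by blast
      moreover have eq: "F g x - g x = (F g x - G (Suc n) x) - (g x - G (Suc n) x)" by simp
      ultimately show ?thesis
        unfolding eq
        by (intro order_trans[OF norm_triangle_ineq4[of "F g x - G (Suc n) x" "g x - G (Suc n) x"]] add_mono)
    qed
    moreover have "(\<lambda>n. c * (c ^ n * B / (1 - c)) + c ^ Suc n * B / (1 - c)) \<longlonglongrightarrow> 0"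
      using tendsto_add[OF tendsto_mult_right_zero[OF lim0, of c] LIMSEQ_Suc[OF lim0]] by (simp only: add_0_left)
    ultimately have "cmod (F g x - g x) \<le> 0"
      by (intro LIMSEQ_le_const[where X = "\<lambda>n. c * (c ^ n * B / (1 - c)) + c ^ Suc n * B / (1 - c)"]) auto
    then show "F g x = g x" by simp
  qed
  then show ?thesis using g by blast
qed

section \<open>The transition operator\<close>

definition pprod :: "(nat \<Rightarrow> real) \<Rightarrow> nat \<Rightarrow> real" where
  "pprod p n = (\<Prod>r=1..n. p r)"

lemma pprod_0 [simp]: "pprod p 0 = 1"
  by (simp add: pprod_def)

lemma pprod_Suc: "pprod p (Suc n) = pprod p n * p (Suc n)"
  by (simp add: pprod_def)

lemma pprod_shift: "pprod p (Suc n) = p 1 * pprod (shift p) n"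
  by (induction n) (simp_all add: pprod_Suc)

lemma pprod_pos: "params d p \<Longrightarrow> 0 < pprod p n"
  by (induction n) (simp_all add: pprod_Suc params_def)

lemma pprod_decseq: "params d p \<Longrightarrow> decseq (pprod p)"
  using pprod_pos[of d p]
  by (intro decseq_SucI) (simp add: pprod_Suc params_def mult_left_le less_imp_le)

lemma pprod_le_1: "params d p \<Longrightarrow> pprod p n \<le> 1"
  using decseqD[OF pprod_decseq, of d p 0 n] by simp

lemma pprod_tendsto:
  assumes "params d p"
  shows "pprod p \<longlonglongrightarrow> inf_prod p"
proof -
  have "bdd_below (range (pprod p))"
    using pprod_pos[OF assms] by (intro bdd_belowI[of _ 0]) (auto intro: less_imp_le)
  then have "convergent (pprod p)"
    using LIMSEQ_decseq_INF pprod_decseq[OF assms] convergent_def by blast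
  then show ?thesis by (simp add: convergent_LIMSEQ_iff inf_prod_def pprod_def[abs_def])
qed

lemma inf_prod_nonneg: "params d p \<Longrightarrow> 0 \<le> inf_prod p"
  using pprod_pos[of d p] by (intro LIMSEQ_le_const[OF pprod_tendsto]) (auto intro: less_imp_le)

lemma inf_prod_le_pprod: "params d p \<Longrightarrow> inf_prod p \<le> pprod p n"
  using decseq_ge[OF pprod_decseq pprod_tendsto] by blast

lemma inf_prod_shift:
  assumes "params d p"
  shows "inf_prod p = p 1 * inf_prod (shift p)"
proof (rule LIMSEQ_unique)
  show "(\<lambda>n. pprod p (Suc n)) \<longlonglongrightarrow> inf_prod p"
    using LIMSEQ_Suc[OF pprod_tendsto[OF assms]] .
  show "(\<lambda>n. pprod p (Suc n)) \<longlonglongrightarrow> p 1 * inf_prod (shift p)"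
    unfolding pprod_shift using pprod_tendsto[OF params_shift[OF assms]] by (intro tendsto_intros)
qed

text \<open>Replaces the \<open>LEAST\<close> in \<open>counter\<close> by a condition on a prefix:
  the carry passes the first \<open>s\<close> digits. The point \<open>x_max d\<close> is covered as
  well and hardly needs separate treatment afterwards.\<close>

lemma counter_gt_iff:
  assumes "x \<in> Gamma d"
  shows "enat s < counter d x \<longleftrightarrow> (\<forall>r\<in>{1..s}. x r = d r - 1)"
proof (cases "x = x_max d")
  case True
  then show ?thesis by (auto simp: counter_def x_max_def)
next
  case False
  let ?P = "\<lambda>r. r \<ge> 1 \<and> x r \<noteq> d r - 1"
  have "\<exists>r. ?P r"
  proof (rule ccontr)
    assume "\<nexists>r. ?P r"
    then have "x = x_max d"
      using Gamma_extensional[OF assms]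
      by (intro extensionalityI[where A = "{1..}"]) (auto simp: x_max_def)
    then show False using False by simp
  qed
  define L where "L = (LEAST r. ?P r)"
  have P: "L \<ge> 1" "x L \<noteq> d L - 1"
    using LeastI_ex[OF \<open>\<exists>r. ?P r\<close>] by (simp_all add: L_def)
  have L: "\<not> ?P r" if "r < L" for r
    using not_less_Least[of r ?P] that unfolding L_def by blast
  have "s < L \<longleftrightarrow> (\<forall>r\<in>{1..s}. x r = d r - 1)"
  proof
    assume "s < L"
    then show "\<forall>r\<in>{1..s}. x r = d r - 1" using L by auto
  next
    assume all: "\<forall>r\<in>{1..s}. x r = d r - 1"
    show "s < L"
    proof (rule ccontr)
      assume "\<not> s < L"
      then have "L \<in> {1..s}" using P(1) by simp
      then show False using all P(2) by blast
    qed
  qed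
  then show ?thesis using False by (simp add: counter_def L_def)
qed

text \<open>Lets counters be compared through \<open>counter_gt_iff\<close>, without a case split on
  being infinite.\<close>

lemma enat_eqI:
  assumes "\<And>s. enat s < a \<longleftrightarrow> enat s < b"
  shows "a = b"
proof (rule ccontr)
  assume "a \<noteq> b"
  then consider "a < b" | "b < a" by fastforce
  then show False
  proof cases
    case 1
    then obtain n where "a = enat n" by (cases a) auto
    then show False using 1 assms[of n] by simp
  next
    case 2
    then obtain n where "b = enat n" by (cases b) auto
    then show False using 2 assms[of n] by simp
  qed
qed

lemma enat_less_eSuc:
  "enat (Suc n) < eSuc c \<longleftrightarrow> enat n < c" "enat 0 < eSuc c"
  by (cases c; simp add: eSuc_enat)+

lemma ball_Suc_1: "(\<forall>r\<in>{1..Suc s}. P r) \<longleftrightarrow> P 1 \<and> (\<forall>r\<in>{1..s}. P (Suc r))"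
proof -
  have "{1..Suc s} = insert 1 (Suc ` {1..s})"
    by (simp add: image_Suc_atLeastAtMost atLeastAtMost_insertL)
  then show ?thesis by (simp only: ball_simps)
qed

lemma counter_pos: "x \<in> Gamma d \<Longrightarrow> enat 0 < counter d x"
  by (simp add: counter_gt_iff)

lemma counter_1:
  assumes "x \<in> Gamma d" "x 1 < d 1 - 1"
  shows "counter d x = enat 1"
proof (rule enat_eqI)
  fix s
  have "(\<forall>r\<in>{1..s}. x r = d r - 1) \<longleftrightarrow> s < 1"
  proof (cases s)
    case (Suc n)
    then show ?thesis using assms(2) unfolding Suc ball_Suc_1 by simp
  qed simp
  then show "enat s < counter d x \<longleftrightarrow> enat s < enat 1"
    unfolding counter_gt_iff[OF assms(1)] enat_ord_simps .
qed

lemma counter_Suc: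
  assumes "x \<in> Gamma d" "x 1 = d 1 - 1"
  shows "counter d x = eSuc (counter (shift d) (tail_digits x))"
proof (rule enat_eqI)
  fix s
  show "enat s < counter d x \<longleftrightarrow> enat s < eSuc (counter (shift d) (tail_digits x))"
  proof (cases s)
    case 0
    then show ?thesis using counter_pos[OF assms(1)] enat_less_eSuc(2) by blast
  next
    case (Suc n)
    have "(\<forall>r\<in>{1..n}. tail_digits x r = shift d r - 1) \<longleftrightarrow> (\<forall>r\<in>{1..n}. x (Suc r) = d (Suc r) - 1)"
      by (rule ball_cong) (auto simp: tail_digits_def)
    then show ?thesis
      unfolding Suc enat_less_eSuc counter_gt_iff[OF assms(1)]
        counter_gt_iff[OF tail_digits_in_Gamma[OF assms(1)]] ball_Suc_1
      using assms(2) by blast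
  qed
qed

text \<open>The carry reaches digit \<open>r\<close> exactly if all earlier digits are maximal. This
  form avoids \<open>counter\<close> and mirrors \<open>predecessor_digit\<close>, so that the two
  maps can be composed digit by digit.\<close>

lemma successor_digit:
  assumes "x \<in> Gamma d" "r \<ge> 1"
  shows "successor d x r =
    (if \<forall>k\<in>{1..<r}. x k = d k - 1 then (if x r = d r - 1 then 0 else x r + 1) else x r)"
proof -
  have lt: "enat r < counter d x \<longleftrightarrow> (\<forall>k\<in>{1..<r}. x k = d k - 1) \<and> x r = d r - 1"
  proof -
    have "{1..r} = insert r {1..<r}" using assms(2) by auto
    then show ?thesis by (auto simp: counter_gt_iff[OF assms(1)])
  qed
  have le: "enat r \<le> counter d x \<longleftrightarrow> (\<forall>k\<in>{1..<r}. x k = d k - 1)"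
  proof -
    have "enat r \<le> counter d x \<longleftrightarrow> enat (r - 1) < counter d x"
      using assms(2) by (cases r) (auto simp: Suc_ile_eq)
    also have "\<dots> \<longleftrightarrow> (\<forall>k\<in>{1..r - 1}. x k = d k - 1)" by (rule counter_gt_iff[OF assms(1)])
    also have "{1..r - 1} = {1..<r}" using assms(2) by auto
    finally show ?thesis .
  qed
  have "enat r = counter d x \<longleftrightarrow> enat r \<le> counter d x \<and> \<not> enat r < counter d x" by auto
  then show ?thesis using assms(2) lt le by (auto simp: successor_def)
qed

lemma successor_in_Gamma:
  assumes "x \<in> Gamma d"
  shows "successor d x \<in> Gamma d"
proof (rule GammaI)
  fix r :: nat assume r: "r \<ge> 1"
  then have "x r < d r" using assms Gamma_digit by blast
  then show "successor d x r < d r" using successor_digit[OF assms r] by auto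
qed (simp add: successor_def)

lemma zero_digits_in_Gamma: "x \<in> Gamma d \<Longrightarrow> zero_digits s x \<in> Gamma d"
  using Gamma_digit[of x d] by (intro GammaI) (force simp: zero_digits_def)+

lemma zero_digits_0: "x \<in> Gamma d \<Longrightarrow> zero_digits 0 x = x"
  by (rule extensionalityI[where A = "{1..}"])
     (auto simp: zero_digits_def dest: Gamma_extensional)

lemma zero_digits_Suc: "zero_digits (Suc s) x = cons_digit 0 (zero_digits s (tail_digits x))"
  by (auto simp: fun_eq_iff zero_digits_def cons_digit_def tail_digits_def restrict_def)

lemma successor_carry:
  assumes "x \<in> Gamma d" "x 1 = d 1 - 1"
  shows "successor d x = cons_digit 0 (successor (shift d) (tail_digits x))"
proof
  fix r
  let ?c = "counter (shift d) (tail_digits x)"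
  have eq: "enat (Suc n) = eSuc ?c \<longleftrightarrow> enat n = ?c" for n
    by (cases ?c) (simp_all add: eSuc_enat)
  have pos: "enat 0 < ?c" using counter_pos[OF tail_digits_in_Gamma[OF assms(1)]] .
  consider "r = 0" | "r = 1" | n where "r = Suc (Suc n)"
    by (metis One_nat_def not0_implies_Suc)
  then show "successor d x r = cons_digit 0 (successor (shift d) (tail_digits x)) r"
  proof cases
    case 2
    have "enat (Suc 0) < eSuc ?c" using pos enat_less_eSuc(1)[of 0 ?c] by simp
    then show ?thesis using 2 by (simp add: successor_def cons_digit_def counter_Suc[OF assms])
  next
    case 3
    have "tail_digits x (Suc n) = x (Suc (Suc n))" by (simp add: tail_digits_def)
    moreover have "enat r < eSuc ?c \<longleftrightarrow> enat (Suc n) < ?c" unfolding 3 by (rule enat_less_eSuc)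
    moreover have "enat r = eSuc ?c \<longleftrightarrow> enat (Suc n) = ?c" unfolding 3 by (rule eq)
    ultimately show ?thesis
      unfolding successor_def cons_digit_def counter_Suc[OF assms] using 3 by simp
  qed (simp add: successor_def cons_digit_def)
qed

lemma successor_no_carry:
  assumes "x \<in> Gamma d" "x 1 < d 1 - 1"
  shows "successor d x = cons_digit (x 1 + 1) (tail_digits x)"
  using Gamma_extensional[OF assms(1)]
  by (intro extensionalityI[where A = "{1..}"])
     (auto simp: successor_def cons_digit_def tail_digits_def counter_1[OF assms])

section \<open>The operator as a weighted average\<close>

definition jump_weight :: "(nat \<Rightarrow> nat) \<Rightarrow> (nat \<Rightarrow> real) \<Rightarrow> (nat \<Rightarrow> nat) \<Rightarrow> nat \<Rightarrow> real" where
  "jump_weight d p x s = (if enat s < counter d x then pprod p s * (1 - p (Suc s)) else 0)"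

definition succ_weight :: "(nat \<Rightarrow> nat) \<Rightarrow> (nat \<Rightarrow> real) \<Rightarrow> (nat \<Rightarrow> nat) \<Rightarrow> real" where
  "succ_weight d p x = (case counter d x of enat n \<Rightarrow> pprod p n | \<infinity> \<Rightarrow> inf_prod p)"

lemma jump_weight_nonneg: "params d p \<Longrightarrow> 0 \<le> jump_weight d p x s"
  using pprod_pos[of d p s] by (auto simp: jump_weight_def params_def)

lemma succ_weight_bounds:
  assumes "params d p"
  shows "0 \<le> succ_weight d p x" "inf_prod p \<le> succ_weight d p x" "succ_weight d p x \<le> 1"
  using pprod_pos[OF assms] inf_prod_nonneg[OF assms] inf_prod_le_pprod[OF assms, of 0]
    pprod_le_1[OF assms] inf_prod_le_pprod[OF assms]
  by (auto simp: succ_weight_def less_imp_le split: enat.split)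

text \<open>The series telescopes, since \<open>pprod p s * (1 - p (Suc s))\<close> is
  \<open>pprod p s - pprod p (Suc s)\<close>. The cut-off at \<open>counter d x\<close> in
  \<open>jump_weight\<close> makes the finite sum and the infinite one instances of the same
  series.\<close>

lemma jump_weight_sums:
  assumes "params d p"
  shows "jump_weight d p x sums (1 - succ_weight d p x)"
proof -
  have tele: "(\<Sum>s<n. pprod p s * (1 - p (Suc s))) = 1 - pprod p n" for n
    by (induction n) (simp_all add: pprod_Suc algebra_simps)
  show ?thesis
  proof (cases "counter d x")
    case (enat n)
    have "jump_weight d p x sums (\<Sum>s<n. jump_weight d p x s)"
      by (rule sums_finite) (auto simp: jump_weight_def enat)
    also have "(\<Sum>s<n. jump_weight d p x s) = (\<Sum>s<n. pprod p s * (1 - p (Suc s)))"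
      by (rule sum.cong) (auto simp: jump_weight_def enat)
    finally show ?thesis by (simp add: tele succ_weight_def enat)
  next
    case infinity
    have "(\<lambda>n. 1 - pprod p n) \<longlonglongrightarrow> 1 - inf_prod p"
      using pprod_tendsto[OF assms] by (intro tendsto_intros)
    then show ?thesis
      unfolding sums_def using tele by (simp add: jump_weight_def infinity succ_weight_def)
  qed
qed

text \<open>
  The term \<open>s = 0\<close> of the series is \<open>(1 - p\<^sub>1) g(x)\<close>, so that the whole operator is an average
  over jumps with total weight \<open>1 - succ_weight d p x\<close>, and over the successor.
\<close>

lemma S_op_sums:
  assumes "params d p" "x \<in> Gamma d" "\<forall>y\<in>Gamma d. cmod (g y) \<le> B"
  shows "(\<lambda>s. of_real (jump_weight d p x s) * g (zero_digits s x)) sums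
     (S_op d p g x - of_real (succ_weight d p x) * g (successor d x))"
proof (cases "counter d x")
  case (enat n)
  then obtain k where k: "n = Suc k" using counter_pos[OF assms(2)] by (cases n) auto
  have "(\<lambda>s. of_real (jump_weight d p x s) * g (zero_digits s x)) sums
      (\<Sum>s<n. of_real (jump_weight d p x s) * g (zero_digits s x))"
    by (rule sums_finite) (auto simp: jump_weight_def enat)
  also have "(\<Sum>s<n. of_real (jump_weight d p x s) * g (zero_digits s x)) =
      (\<Sum>s<n. of_real (pprod p s * (1 - p (Suc s))) * g (zero_digits s x))"
    by (rule sum.cong) (auto simp: jump_weight_def enat)
  also have "\<dots> = of_real (1 - p 1) * g x + (\<Sum>s=1..k. of_real (pprod p s * (1 - p (s + 1))) * g (zero_digits s x))"
    unfolding k sum.lessThan_Suc_shift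
    by (simp add: zero_digits_0[OF assms(2)] sum.atLeast1_atMost_eq)
  also have "\<dots> = S_op d p g x - of_real (succ_weight d p x) * g (successor d x)"
    using assms(2) by (simp add: S_op_def enat k succ_weight_def pprod_def)
  finally show ?thesis .
next
  case infinity
  let ?f = "\<lambda>s. of_real (jump_weight d p x s) * g (zero_digits s x)"
  have "summable (\<lambda>s. jump_weight d p x s * B)"
    using jump_weight_sums[OF assms(1), of x] by (intro summable_mult2) (auto simp: sums_iff)
  then have "summable ?f"
  proof (rule summable_comparison_test')
    show "norm (?f s) \<le> jump_weight d p x s * B" if "s \<ge> 0" for s
      using assms zero_digits_in_Gamma[OF assms(2)] jump_weight_nonneg[OF assms(1), of x s]
      by (auto simp: norm_mult intro!: mult_left_mono)
  qed
  then have "?f sums (\<Sum>s. ?f s)" by (rule summable_sums)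
  also have "(\<Sum>s. ?f s) = (\<Sum>s. ?f (Suc s)) + ?f 0"
    using suminf_split_head[OF \<open>summable ?f\<close>] by simp
  also have "\<dots> = S_op d p g x - of_real (succ_weight d p x) * g (successor d x)"
    using assms(2)
    by (simp add: S_op_def infinity jump_weight_def succ_weight_def zero_digits_0[OF assms(2)] pprod_def)
  finally show ?thesis .
qed

section \<open>Recursion of the operator in the first digit\<close>

definition fib :: "(nat \<Rightarrow> nat) \<Rightarrow> nat \<Rightarrow> ((nat \<Rightarrow> nat) \<Rightarrow> complex) \<Rightarrow> (nat \<Rightarrow> nat) \<Rightarrow> complex" where
  "fib d a g = (\<lambda>y. if y \<in> Gamma (shift d) then g (cons_digit a y) else 0)"

lemma S_op_rec_no_carry:
  assumes "params d p" "x \<in> Gamma d" "x 1 < d 1 - 1"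
  shows "S_op d p g x = of_real (1 - p 1) * g x + of_real (p 1) * g (cons_digit (x 1 + 1) (tail_digits x))"
  using assms(2) by (simp add: S_op_def counter_1[OF assms(2,3)] successor_no_carry[OF assms(2,3)])

text \<open>The successor and all jumps with s >= 1 set the first digit to 0, so they only see the
  fibre of digit 0, and their weights are p_1 times those of the shifted parameters. Only the jump
  with s = 0, which stays at \<open>x\<close>, is left over.\<close>

lemma S_op_rec_carry:
  assumes "params d p" "x \<in> Gamma d" "x 1 = d 1 - 1" "\<forall>y\<in>Gamma d. cmod (g y) \<le> B"
  shows "S_op d p g x = of_real (1 - p 1) * g x
    + of_real (p 1) * S_op (shift d) (shift p) (fib d 0 g) (tail_digits x)"
proof -
  let ?y = "tail_digits x" and ?d = "shift d" and ?p = "shift p" and ?h = "fib d 0 g"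
  note y = tail_digits_in_Gamma[OF assms(2)] and pos = params_1[OF assms(1)]
  have bd: "\<forall>y\<in>Gamma ?d. cmod (?h y) \<le> B"
    using assms(4) pos by (auto simp: fib_def intro!: cons_digit_in_Gamma)
  have jw: "jump_weight d p x (Suc s) = p 1 * jump_weight ?d ?p ?y s" for s
    by (simp add: jump_weight_def counter_Suc[OF assms(2,3)] pprod_shift enat_less_eSuc del: iless_Suc_eq)
  have jw0: "jump_weight d p x 0 = 1 - p 1"
    using counter_pos[OF assms(2)] by (simp add: jump_weight_def)
  have sw: "succ_weight d p x = p 1 * succ_weight ?d ?p ?y"
    by (cases "counter ?d ?y")
       (simp_all add: succ_weight_def counter_Suc[OF assms(2,3)] pprod_shift eSuc_enat
         inf_prod_shift[OF assms(1)])
  have h: "g (zero_digits (Suc s) x) = ?h (zero_digits s ?y)" for s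
    using zero_digits_in_Gamma[OF y] by (simp add: fib_def zero_digits_Suc)
  have hs: "g (successor d x) = ?h (successor ?d ?y)"
    using successor_in_Gamma[OF y] by (simp add: fib_def successor_carry[OF assms(2,3)])
  have "(\<lambda>s. of_real (p 1) * (of_real (jump_weight ?d ?p ?y s) * ?h (zero_digits s ?y))) sums
     (of_real (p 1) * (S_op ?d ?p ?h ?y - of_real (succ_weight ?d ?p ?y) * ?h (successor ?d ?y)))"
    by (intro sums_mult S_op_sums[OF params_shift[OF assms(1)] y bd])
  then have "(\<lambda>s. of_real (jump_weight d p x (Suc s)) * g (zero_digits (Suc s) x)) sums
     (of_real (p 1) * S_op ?d ?p ?h ?y - of_real (succ_weight d p x) * g (successor d x))"
    unfolding jw sw hs h by (simp add: algebra_simps)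
  then have "(\<lambda>s. of_real (jump_weight d p x s) * g (zero_digits s x)) sums
     (of_real (p 1) * S_op ?d ?p ?h ?y - of_real (succ_weight d p x) * g (successor d x)
       + of_real (1 - p 1) * g x)"
    by (subst (asm) sums_Suc_iff) (simp add: jw0 zero_digits_0[OF assms(2)])
  from sums_unique2[OF this S_op_sums[OF assms(1,2,4)]] show ?thesis
    by (simp add: algebra_simps)
qed

section \<open>Linearity, norm bounds and continuity of the image\<close>

lemma S_op_linear:
  assumes "params d p" "x \<in> Gamma d" "\<forall>y\<in>Gamma d. cmod (g y) \<le> B" "\<forall>y\<in>Gamma d. cmod (h y) \<le> C"
  shows "S_op d p (\<lambda>y. a * g y + b * h y) x = a * S_op d p g x + b * S_op d p h x"
proof -
  have bd: "\<forall>y\<in>Gamma d. cmod (a * g y + b * h y) \<le> cmod a * B + cmod b * C"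
  proof
    fix y assume "y \<in> Gamma d"
    then show "cmod (a * g y + b * h y) \<le> cmod a * B + cmod b * C"
      using assms(3,4)
      by (intro order_trans[OF norm_triangle_ineq] add_mono) (auto simp: norm_mult intro!: mult_left_mono)
  qed
  have "(\<lambda>s. a * (of_real (jump_weight d p x s) * g (zero_digits s x))
      + b * (of_real (jump_weight d p x s) * h (zero_digits s x))) sums
     (a * (S_op d p g x - of_real (succ_weight d p x) * g (successor d x))
      + b * (S_op d p h x - of_real (succ_weight d p x) * h (successor d x)))"
    by (intro sums_add sums_mult S_op_sums[OF assms(1,2,3)] S_op_sums[OF assms(1,2,4)])
  then have "(\<lambda>s. of_real (jump_weight d p x s) * (a * g (zero_digits s x) + b * h (zero_digits s x))) sums
     (a * S_op d p g x + b * S_op d p h x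
       - of_real (succ_weight d p x) * (a * g (successor d x) + b * h (successor d x)))"
    by (simp add: algebra_simps)
  from sums_unique2[OF this S_op_sums[OF assms(1,2) bd]] show ?thesis by simp
qed

text \<open>The jumps have total weight \<open>1 - succ_weight d p x\<close>. Both the norm bound
  and the comparison with the odometer start from here.\<close>

lemma S_op_near_successor:
  assumes "params d p" "x \<in> Gamma d" "\<forall>y\<in>Gamma d. cmod (g y) \<le> B"
  shows "cmod (S_op d p g x - of_real (succ_weight d p x) * g (successor d x)) \<le> (1 - succ_weight d p x) * B"
proof -
  let ?f = "\<lambda>s. of_real (jump_weight d p x s) * g (zero_digits s x)"
  have maj: "(\<lambda>s. jump_weight d p x s * B) sums ((1 - succ_weight d p x) * B)"
    by (intro sums_mult2 jump_weight_sums[OF assms(1)])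
  have le: "norm (?f s) \<le> jump_weight d p x s * B" for s
    using assms zero_digits_in_Gamma[OF assms(2)] jump_weight_nonneg[OF assms(1), of x s]
    by (auto simp: norm_mult intro!: mult_left_mono)
  have "norm (suminf ?f) \<le> (\<Sum>s. jump_weight d p x s * B)"
    by (rule norm_suminf_le[OF le]) (use maj in \<open>auto simp: sums_iff\<close>)
  then show ?thesis using maj S_op_sums[OF assms] by (simp add: sums_iff)
qed

lemma S_op_contraction:
  assumes "params d p" "x \<in> Gamma d" "\<forall>y\<in>Gamma d. cmod (g y) \<le> B"
  shows "cmod (S_op d p g x) \<le> B"
proof -
  let ?v = "succ_weight d p x"
  have "cmod (of_real ?v * g (successor d x)) \<le> ?v * B"
    using assms successor_in_Gamma[OF assms(2)] succ_weight_bounds[OF assms(1), of x]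
    by (auto simp: norm_mult intro!: mult_left_mono)
  moreover have "cmod (S_op d p g x) \<le> cmod (S_op d p g x - of_real ?v * g (successor d x))
      + cmod (of_real ?v * g (successor d x))"
    by (metis diff_add_cancel norm_triangle_ineq)
  ultimately show ?thesis using S_op_near_successor[OF assms] by (simp add: algebra_simps)
qed

text \<open>There are two errors of at most (1 - v) B each, where v is
  \<open>succ_weight d p x\<close>: the jumps, and the weight v in place of 1 on the successor.
  Since v is at least \<open>inf_prod p\<close> at every point, the bound is uniform.\<close>

lemma S_op_isometry_defect:
  assumes "params d p" "x \<in> Gamma d" "\<forall>y\<in>Gamma d. cmod (g y) \<le> B"
  shows "cmod (S_op d p g x - g (successor d x)) \<le> 2 * (1 - inf_prod p) * B"
proof -
  let ?v = "succ_weight d p x"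
  have B: "B \<ge> 0" using assms(2,3) norm_ge_zero order_trans by blast
  have "cmod (of_real (1 - ?v) * g (successor d x)) \<le> (1 - ?v) * B"
    unfolding norm_mult norm_of_real
    using assms successor_in_Gamma[OF assms(2)] succ_weight_bounds[OF assms(1), of x]
    by (auto intro!: mult_left_mono)
  moreover have "cmod (S_op d p g x - g (successor d x)) \<le>
      cmod (S_op d p g x - of_real ?v * g (successor d x)) + cmod (of_real (1 - ?v) * g (successor d x))"
  proof -
    have eq: "S_op d p g x - g (successor d x) =
        (S_op d p g x - of_real ?v * g (successor d x)) - of_real (1 - ?v) * g (successor d x)"
      by (simp add: algebra_simps)
    show ?thesis unfolding eq by (rule norm_triangle_ineq4)
  qed
  ultimately have "cmod (S_op d p g x - g (successor d x)) \<le> (1 - ?v) * B + (1 - ?v) * B"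
    using S_op_near_successor[OF assms] by linarith
  also have "\<dots> = 2 * (1 - ?v) * B" by simp
  also have "\<dots> \<le> 2 * (1 - inf_prod p) * B"
    using succ_weight_bounds[OF assms(1), of x] B by (intro mult_right_mono) auto
  finally show ?thesis .
qed

lemma S_op_const:
  assumes "params d p" "x \<in> Gamma d"
  shows "S_op d p (\<lambda>y. c) x = c"
proof -
  have "(\<lambda>s. of_real (jump_weight d p x s) * c) sums (of_real (1 - succ_weight d p x) * c)"
    by (intro sums_mult2 sums_of_real jump_weight_sums[OF assms(1)])
  from sums_unique2[OF this S_op_sums[OF assms, of "\<lambda>_. c" "cmod c"]] show ?thesis
    by (simp add: algebra_simps)
qed

lemma S_op_diff:
  assumes "params d p" "x \<in> Gamma d" "\<forall>y\<in>Gamma d. cmod (g y) \<le> B" "\<forall>y\<in>Gamma d. cmod (h y) \<le> C"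
  shows "S_op d p (\<lambda>y. g y - h y) x = S_op d p g x - S_op d p h x"
  using S_op_linear[OF assms, of 1 "-1"] by simp

text \<open>Continuity of the image is not evident, because the formula for S changes with the
  counter, which is unbounded near \<open>x_max d\<close>. The factor 2 arises for m = 0, where both
  values are compared with \<open>g x\<close>; a carry preserves it, since (1 - p_1) e + p_1 2e is
  at most 2e.\<close>

lemma S_op_oscillation:
  assumes "params d p" "\<forall>y\<in>Gamma d. cmod (g y) \<le> B" "x \<in> Gamma d" "y \<in> Gamma d" "agree m x y"
    and "\<forall>u\<in>Gamma d. \<forall>v\<in>Gamma d. agree m u v \<longrightarrow> cmod (g u - g v) \<le> e"
  shows "cmod (S_op d p g x - S_op d p g y) \<le> 2 * e"
  using assms
proof (induction m arbitrary: d p g x y)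
  case 0
  \<comment> \<open>\<open>agree 0\<close> always holds, so here the whole oscillation of
    \<open>g\<close> is at most \<open>e\<close>.\<close>
  have e: "cmod (g u - g x) \<le> e" if "u \<in> Gamma d" for u
    using 0 that by (auto simp: agree_def)
  have "cmod (S_op d p g z - g x) \<le> e" if "z \<in> Gamma d" for z
  proof -
    have "cmod (S_op d p (\<lambda>u. g u - g x) z) \<le> e"
      using e by (intro S_op_contraction[OF "0.prems"(1) that]) auto
    moreover have "S_op d p (\<lambda>u. g u - g x) z = S_op d p g z - g x"
      using S_op_diff[OF "0.prems"(1) that "0.prems"(2), of "\<lambda>_. g x" "cmod (g x)"]
        S_op_const[OF "0.prems"(1) that] by simp
    ultimately show ?thesis by simp
  qed
  from this[OF "0.prems"(3)] this[OF "0.prems"(4)] show ?case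
    using norm_triangle_ineq4[of "S_op d p g x - g x" "S_op d p g y - g x"] by simp
next
  case (Suc m)
  note prems = Suc.prems and pos = params_1[OF Suc.prems(1)]
  have e: "e \<ge> 0" using prems(3-6) norm_ge_zero order_trans by blast
  have 1: "cmod (of_real (1 - p 1) * (g x - g y)) \<le> (1 - p 1) * e"
    unfolding norm_mult norm_of_real using prems(3-6) pos by (auto intro!: mult_left_mono)
  have xy: "x 1 = y 1" using agree_Suc_1[OF prems(5)] by simp
  have tl: "agree m (tail_digits x) (tail_digits y)" using agree_tail_digits[OF prems(5)] .
  note tx = tail_digits_in_Gamma[OF prems(3)] and ty = tail_digits_in_Gamma[OF prems(4)]
  obtain D where D: "S_op d p g x - S_op d p g y = of_real (1 - p 1) * (g x - g y) + of_real (p 1) * D"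
    "cmod D \<le> 2 * e"
  proof (cases "x 1 < d 1 - 1")
    case True
    let ?D = "g (cons_digit (x 1 + 1) (tail_digits x)) - g (cons_digit (x 1 + 1) (tail_digits y))"
    have "cmod ?D \<le> e"
      using prems(6) True cons_digit_in_Gamma[OF tx] cons_digit_in_Gamma[OF ty] agree_cons_digit[OF tl]
      by auto
    then have "cmod ?D \<le> 2 * e" using e by simp
    moreover have "S_op d p g x - S_op d p g y = of_real (1 - p 1) * (g x - g y) + of_real (p 1) * ?D"
      unfolding S_op_rec_no_carry[OF prems(1,3) True] S_op_rec_no_carry[OF prems(1,4) True[unfolded xy]] xy
      by (simp add: algebra_simps)
    ultimately show ?thesis by (intro that[of ?D])
  next
    case False
    then have x1: "x 1 = d 1 - 1" using Gamma_digit[OF prems(3), of 1] by simp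
    let ?h = "fib d 0 g"
    let ?D = "S_op (shift d) (shift p) ?h (tail_digits x) - S_op (shift d) (shift p) ?h (tail_digits y)"
    have "cmod ?D \<le> 2 * e"
    proof (rule Suc.IH[OF params_shift[OF prems(1)] _ tx ty tl])
      show "\<forall>y\<in>Gamma (shift d). cmod (fib d 0 g y) \<le> B"
        using prems(2) pos cons_digit_in_Gamma[of _ d 0] by (auto simp: fib_def)
      show "\<forall>u\<in>Gamma (shift d). \<forall>v\<in>Gamma (shift d). agree m u v \<longrightarrow> cmod (fib d 0 g u - fib d 0 g v) \<le> e"
        using prems(6) pos cons_digit_in_Gamma[of _ d 0] agree_cons_digit by (auto simp: fib_def)
    qed
    moreover have "S_op d p g x - S_op d p g y = of_real (1 - p 1) * (g x - g y) + of_real (p 1) * ?D"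
      unfolding S_op_rec_carry[OF prems(1,3) x1 prems(2)]
        S_op_rec_carry[OF prems(1,4) x1[unfolded xy] prems(2)]
      by (simp add: algebra_simps)
    ultimately show ?thesis by (intro that[of ?D])
  qed
  have "cmod (of_real (p 1) * D) \<le> p 1 * (2 * e)"
    unfolding norm_mult norm_of_real using D(2) pos by (auto intro!: mult_left_mono)
  then have "cmod (S_op d p g x - S_op d p g y) \<le> (1 - p 1) * e + p 1 * (2 * e)"
    unfolding D(1) using 1 by (intro order_trans[OF norm_triangle_ineq] add_mono)
  also have "\<dots> = e + p 1 * e" by (simp add: algebra_simps)
  also have "\<dots> \<le> 2 * e" using mult_right_mono[OF pos(3) e] by simp
  finally show ?case .
qed

lemma S_op_in_C_Gamma:
  assumes "params d p" "g \<in> C_Gamma d"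
  shows "S_op d p g \<in> C_Gamma d"
  unfolding C_Gamma_iff
proof (intro conjI allI impI)
  fix e :: real assume "e > 0"
  obtain B where B: "\<forall>y\<in>Gamma d. cmod (g y) \<le> B" using C_Gamma_bounded[OF assms(2)] by blast
  obtain m where "\<forall>x\<in>Gamma d. \<forall>y\<in>Gamma d. agree m x y \<longrightarrow> cmod (g x - g y) \<le> e / 2"
    using C_GammaD(2)[OF assms(2)] half_gt_zero[OF \<open>e > 0\<close>] by blast
  then have "\<forall>x\<in>Gamma d. \<forall>y\<in>Gamma d. agree m x y \<longrightarrow> cmod (S_op d p g x - S_op d p g y) \<le> 2 * (e / 2)"
    using S_op_oscillation[OF assms(1) B] by blast
  then show "\<exists>m. \<forall>x\<in>Gamma d. \<forall>y\<in>Gamma d. agree m x y \<longrightarrow> cmod (S_op d p g x - S_op d p g y) \<le> e" by auto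
qed (simp add: S_op_def)

section \<open>Invertibility\<close>

text \<open>Bounded below and onto. In this form the property passes from the shifted parameters to
  the original ones; a bounded linear inverse is built only in
  \<open>invertible_at_not_spectrum\<close>.\<close>

definition invertible_at :: "(nat \<Rightarrow> nat) \<Rightarrow> (nat \<Rightarrow> real) \<Rightarrow> complex \<Rightarrow> bool" where
  "invertible_at d p l \<longleftrightarrow>
     (\<exists>K\<ge>0. \<forall>g\<in>C_Gamma d. sup_norm d g \<le> K * sup_norm d (shifted (S_op d p) l g)) \<and>
     (\<forall>y\<in>C_Gamma d. \<exists>g\<in>C_Gamma d. shifted (S_op d p) l g = y)"

lemma S_op_outside: "x \<notin> Gamma d \<Longrightarrow> S_op d p g x = 0"
  by (simp add: S_op_def)

lemma shifted_in_C_Gamma: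
  "params d p \<Longrightarrow> g \<in> C_Gamma d \<Longrightarrow> shifted (S_op d p) l g \<in> C_Gamma d"
  unfolding shifted_def by (intro C_Gamma_diff C_Gamma_cmult S_op_in_C_Gamma)

lemma S_op_lincomb:
  assumes "params d p" "g \<in> C_Gamma d" "h \<in> C_Gamma d"
  shows "S_op d p (\<lambda>x. a * g x + b * h x) = (\<lambda>x. a * S_op d p g x + b * S_op d p h x)"
proof
  fix x
  obtain B C where "\<forall>y\<in>Gamma d. cmod (g y) \<le> B" "\<forall>y\<in>Gamma d. cmod (h y) \<le> C"
    using C_Gamma_bounded assms by metis
  then show "S_op d p (\<lambda>x. a * g x + b * h x) x = a * S_op d p g x + b * S_op d p h x"
    using S_op_linear[OF assms(1)] S_op_outside by (cases "x \<in> Gamma d") auto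
qed

lemma shifted_lincomb:
  assumes "params d p" "g \<in> C_Gamma d" "h \<in> C_Gamma d"
  shows "shifted (S_op d p) l (\<lambda>x. a * g x + b * h x)
    = (\<lambda>x. a * shifted (S_op d p) l g x + b * shifted (S_op d p) l h x)"
  unfolding shifted_def S_op_lincomb[OF assms] by (simp add: algebra_simps fun_eq_iff)

lemma C_Gamma_lincomb:
  "g \<in> C_Gamma d \<Longrightarrow> h \<in> C_Gamma d \<Longrightarrow> (\<lambda>x. a * g x + b * h x) \<in> C_Gamma d"
  by (intro C_Gamma_add C_Gamma_cmult)

lemma S_op_zero: "params d p \<Longrightarrow> S_op d p (\<lambda>x. 0) = (\<lambda>x. 0)"
  using S_op_lincomb[OF _ C_Gamma_zero C_Gamma_zero, of d p 0 0] by simp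

lemma sup_norm_zero: "Gamma d \<noteq> {} \<Longrightarrow> sup_norm d (\<lambda>x. 0) = 0"
  by (simp add: sup_norm_def)

text \<open>Surjectivity gives a right inverse \<open>R\<close> by choice. The lower bound makes S -
  l injective, and injectivity makes \<open>R\<close> linear and also a left inverse.\<close>

lemma invertible_at_not_spectrum:
  assumes "params d p" "invertible_at d p l"
  shows "l \<notin> spectrum_on (C_Gamma d) (sup_norm d) (S_op d p)"
proof -
  let ?T = "shifted (S_op d p) l"
  obtain K where K: "\<And>g. g \<in> C_Gamma d \<Longrightarrow> sup_norm d g \<le> K * sup_norm d (?T g)"
    using assms(2) unfolding invertible_at_def by blast
  obtain R where R: "\<And>y. y \<in> C_Gamma d \<Longrightarrow> R y \<in> C_Gamma d \<and> ?T (R y) = y"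
    using assms(2) unfolding invertible_at_def by metis
  have inj: "g = h" if gh: "g \<in> C_Gamma d" "h \<in> C_Gamma d" "?T g = ?T h" for g h
  proof -
    have "?T (\<lambda>x. 1 * g x + (-1) * h x) = (\<lambda>x. 0)"
      unfolding shifted_lincomb[OF assms(1) gh(1,2)] gh(3) by simp
    then have "sup_norm d (\<lambda>x. 1 * g x + (-1) * h x) \<le> 0"
      using K[OF C_Gamma_lincomb[OF gh(1,2), of 1 "-1"]] sup_norm_zero[OF Gamma_nonempty[OF assms(1)]]
      by simp
    then have "(\<lambda>x. 1 * g x + (-1) * h x) = (\<lambda>x. 0)"
      by (rule sup_norm_eq_0[OF C_Gamma_lincomb[OF gh(1,2)]])
    then show "g = h" by (simp add: fun_eq_iff)
  qed
  have lin: "R (\<lambda>x. a * g x + b * h x) = (\<lambda>x. a * R g x + b * R h x)"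
    if gh: "g \<in> C_Gamma d" "h \<in> C_Gamma d" for a b g h
  proof (rule inj)
    show "?T (R (\<lambda>x. a * g x + b * h x)) = ?T (\<lambda>x. a * R g x + b * R h x)"
      using R[OF gh(1)] R[OF gh(2)] R[OF C_Gamma_lincomb[OF gh]] shifted_lincomb[OF assms(1), of "R g" "R h"]
      by simp
  qed (use R gh C_Gamma_lincomb in blast)+
  have "bounded_operator_on (C_Gamma d) (sup_norm d) R"
    unfolding bounded_operator_on_def
  proof (intro conjI ballI allI)
    fix g h assume gh: "g \<in> C_Gamma d" "h \<in> C_Gamma d"
    show "R (\<lambda>x. g x + h x) = (\<lambda>x. R g x + R h x)" using lin[OF gh, of 1 1] by simp
  next
    fix c g assume g: "g \<in> C_Gamma d"
    show "R (\<lambda>x. c * g x) = (\<lambda>x. c * R g x)" using lin[OF g g, of c 0] by simp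
  next
    show "\<exists>K. \<forall>g\<in>C_Gamma d. sup_norm d (R g) \<le> K * sup_norm d g"
      using K R by metis
  qed (use R in blast)
  moreover have "R (?T g) = g \<and> ?T (R g) = g" if "g \<in> C_Gamma d" for g
    using R inj shifted_in_C_Gamma[OF assms(1)] that by metis
  ultimately show ?thesis unfolding spectrum_on_def by blast
qed

text \<open>Rescaling to norm 1 multiplies both sides of the inequality by the same factor, so
  approximate eigenfunctions need not be normalised.\<close>

lemma approx_spectrum_iff:
  assumes "params d p"
  shows "l \<in> approx_spectrum_on (C_Gamma d) (sup_norm d) (S_op d p) \<longleftrightarrow>
    (\<forall>e>0. \<exists>g\<in>C_Gamma d. g \<noteq> (\<lambda>x. 0) \<and> sup_norm d (shifted (S_op d p) l g) \<le> e * sup_norm d g)"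
    (is "_ \<longleftrightarrow> ?R")
proof -
  let ?A = "{g \<in> C_Gamma d. sup_norm d g = 1}" and ?f = "\<lambda>g. sup_norm d (shifted (S_op d p) l g)"
  note ne = Gamma_nonempty[OF assms]
  \<comment> \<open>The constant 1 shows that the infimum is taken over a nonempty set.\<close>
  have "sup_norm d (\<lambda>x. if x \<in> Gamma d then 1 else 0) = 1"
    using ne by (simp add: sup_norm_def)
  then have A: "?A \<noteq> {}" using C_Gamma_const by blast
  have nonneg: "0 \<le> ?f g" if "g \<in> ?A" for g
    using that by (intro sup_norm_nonneg[OF ne] shifted_in_C_Gamma[OF assms]) auto
  have bdd: "bdd_below (?f ` ?A)" using nonneg by (intro bdd_belowI2[of _ 0]) auto
  have "(INF g\<in>?A. ?f g) = 0 \<longleftrightarrow> ?R"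
  proof
    assume inf: "(INF g\<in>?A. ?f g) = 0"
    show ?R
    proof (intro allI impI)
      fix e :: real assume "e > 0"
      then obtain g where g: "g \<in> ?A" "?f g < e"
        using cINF_less_iff[OF A bdd, of e] inf by auto
      moreover have "g \<noteq> (\<lambda>x. 0)" using g(1) sup_norm_zero[OF ne] by auto
      ultimately show "\<exists>g\<in>C_Gamma d. g \<noteq> (\<lambda>x. 0) \<and> ?f g \<le> e * sup_norm d g" by auto
    qed
  next
    assume R: ?R
    show "(INF g\<in>?A. ?f g) = 0"
    proof (rule antisym)
      show "(INF g\<in>?A. ?f g) \<le> 0"
      proof (rule field_le_epsilon)
        fix e :: real assume "e > 0"
        then obtain g where g: "g \<in> C_Gamma d" "g \<noteq> (\<lambda>x. 0)" "?f g \<le> e * sup_norm d g" using R by blast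
        let ?N = "sup_norm d g"
        have N: "?N > 0" using sup_norm_pos[OF ne g(1,2)] .
        let ?c = "of_real (inverse ?N) :: complex"
        let ?h = "\<lambda>x. ?c * g x"
        have "?h \<in> ?A"
          using C_Gamma_cmult[OF g(1)] sup_norm_cmult[OF ne g(1), of ?c] N by (simp add: norm_inverse)
        moreover have "shifted (S_op d p) l ?h = (\<lambda>x. ?c * shifted (S_op d p) l g x)"
          using shifted_lincomb[OF assms g(1) g(1), of l ?c 0] by simp
        then have fh: "?f ?h = inverse ?N * ?f g"
          using sup_norm_cmult[OF ne shifted_in_C_Gamma[OF assms g(1)], of ?c] N by (simp add: norm_inverse)
        have "?f ?h \<le> e" unfolding fh using g(3) N by (simp add: field_simps)
        ultimately show "(INF g\<in>?A. ?f g) \<le> 0 + e" by (simp add: cINF_lower2[OF bdd])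
      qed
      show "0 \<le> (INF g\<in>?A. ?f g)" by (rule cINF_greatest[OF A nonneg])
    qed
  qed
  then show ?thesis by (simp add: approx_spectrum_on_def)
qed

lemma approx_spectrum_subset_spectrum:
  assumes "params d p"
  shows "approx_spectrum_on (C_Gamma d) (sup_norm d) (S_op d p)
    \<subseteq> spectrum_on (C_Gamma d) (sup_norm d) (S_op d p)"
proof (rule subsetI, rule ccontr)
  fix l
  let ?T = "shifted (S_op d p) l"
  assume l: "l \<in> approx_spectrum_on (C_Gamma d) (sup_norm d) (S_op d p)"
    "l \<notin> spectrum_on (C_Gamma d) (sup_norm d) (S_op d p)"
  then obtain R where R: "bounded_operator_on (C_Gamma d) (sup_norm d) R"
      "\<And>g. g \<in> C_Gamma d \<Longrightarrow> R (?T g) = g"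
    unfolding spectrum_on_def by blast
  then obtain K where K: "\<And>g. g \<in> C_Gamma d \<Longrightarrow> sup_norm d (R g) \<le> K * sup_norm d g"
    unfolding bounded_operator_on_def by blast
  \<comment> \<open>\<open>K\<close> comes without a sign, hence |K| + 1. With this defect the
    bounded left inverse would give that the norm of \<open>g\<close> is at most half of
    itself.\<close>
  obtain g where g: "g \<in> C_Gamma d" "g \<noteq> (\<lambda>x. 0)"
      "sup_norm d (?T g) \<le> (1 / (2 * (\<bar>K\<bar> + 1))) * sup_norm d g"
    using l(1) unfolding approx_spectrum_iff[OF assms] by (metis add_nonneg_pos abs_ge_zero
      zero_less_one zero_less_divide_1_iff mult_pos_pos zero_less_numeral)
  note N = sup_norm_pos[OF Gamma_nonempty[OF assms] g(1,2)]
  have "sup_norm d g \<le> K * sup_norm d (?T g)"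
    using K[OF shifted_in_C_Gamma[OF assms g(1)], of l] R(2)[OF g(1)] by simp
  also have "\<dots> \<le> (\<bar>K\<bar> + 1) * sup_norm d (?T g)"
    by (intro mult_right_mono sup_norm_nonneg Gamma_nonempty[OF assms] shifted_in_C_Gamma[OF assms] g) auto
  also have "\<dots> \<le> (\<bar>K\<bar> + 1) * ((1 / (2 * (\<bar>K\<bar> + 1))) * sup_norm d g)"
    using g(3) by (intro mult_left_mono) auto
  also have "\<dots> = sup_norm d g / 2" by (simp add: field_simps)
  finally show False using N by simp
qed

text \<open>For fixed \<open>y\<close> the contraction has a fixed point, which solves the equation.
  Comparing \<open>F g y = g\<close> with the value 0 of \<open>F\<close> at 0 and 0 gives the lower
  bound with constant K / (1 - c); this is why the estimate lets both arguments vary.\<close>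

lemma invertible_at_of_contraction:
  assumes "params d p" "0 \<le> c" "c < 1" "0 \<le> K"
    and F: "\<And>g y. g \<in> C_Gamma d \<Longrightarrow> y \<in> C_Gamma d \<Longrightarrow> F g y \<in> C_Gamma d"
    and sol: "\<And>g y. g \<in> C_Gamma d \<Longrightarrow> y \<in> C_Gamma d \<Longrightarrow> shifted (S_op d p) l g = y \<longleftrightarrow> F g y = g"
    and contr: "\<And>g h y z B C x. \<lbrakk>g \<in> C_Gamma d; h \<in> C_Gamma d; y \<in> C_Gamma d; z \<in> C_Gamma d;
      \<forall>x\<in>Gamma d. cmod (g x - h x) \<le> B; \<forall>x\<in>Gamma d. cmod (y x - z x) \<le> C; x \<in> Gamma d\<rbrakk>
      \<Longrightarrow> cmod (F g y x - F h z x) \<le> c * B + K * C"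
  shows "invertible_at d p l"
  unfolding invertible_at_def
proof (intro conjI)
  note ne = Gamma_nonempty[OF assms(1)]
  show "\<forall>y\<in>C_Gamma d. \<exists>g\<in>C_Gamma d. shifted (S_op d p) l g = y"
  proof
    fix y assume y: "y \<in> C_Gamma d"
    have "\<exists>g\<in>C_Gamma d. F g y = g"
      using contr[OF _ _ y y, of _ _ _ 0] F[OF _ y]
      by (intro contraction_fixpoint[OF _ assms(2,3)]) auto
    then show "\<exists>g\<in>C_Gamma d. shifted (S_op d p) l g = y" using sol y by blast
  qed
  have F0: "F (\<lambda>x. 0) (\<lambda>x. 0) = (\<lambda>x. 0)"
    using sol[OF C_Gamma_zero C_Gamma_zero] S_op_zero[OF assms(1)] by (simp add: shifted_def)
  have "sup_norm d g \<le> K / (1 - c) * sup_norm d (shifted (S_op d p) l g)" if g: "g \<in> C_Gamma d" for g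
  proof -
    let ?y = "shifted (S_op d p) l g"
    have y: "?y \<in> C_Gamma d" using shifted_in_C_Gamma[OF assms(1) g] .
    have "F g ?y = g" using sol[OF g y] by simp
    then have "cmod (g x) \<le> c * sup_norm d g + K * sup_norm d ?y" if "x \<in> Gamma d" for x
      using contr[OF g C_Gamma_zero y C_Gamma_zero _ _ that, of "sup_norm d g" "sup_norm d ?y"]
        cmod_le_sup_norm g y F0 by simp
    then have "sup_norm d g \<le> c * sup_norm d g + K * sup_norm d ?y" using sup_norm_le[OF ne] by blast
    then show ?thesis using assms(3) by (simp add: field_simps)
  qed
  moreover have "K / (1 - c) \<ge> 0" using assms by simp
  ultimately show "\<exists>K\<ge>0. \<forall>g\<in>C_Gamma d. sup_norm d g \<le> K * sup_norm d (shifted (S_op d p) l g)"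
    by blast
qed

lemma S_op_diff_bound:
  assumes "params d p" "g \<in> C_Gamma d" "h \<in> C_Gamma d" "\<forall>x\<in>Gamma d. cmod (g x - h x) \<le> B" "x \<in> Gamma d"
  shows "cmod (S_op d p g x - S_op d p h x) \<le> B"
    "cmod ((S_op d p g x - S_op d p h x) - (g (successor d x) - h (successor d x))) \<le> 2 * (1 - inf_prod p) * B"
proof -
  have "S_op d p (\<lambda>x. g x - h x) = (\<lambda>x. S_op d p g x - S_op d p h x)"
    using S_op_lincomb[OF assms(1-3), of 1 "-1"] by simp
  then show "cmod (S_op d p g x - S_op d p h x) \<le> B"
    "cmod ((S_op d p g x - S_op d p h x) - (g (successor d x) - h (successor d x))) \<le> 2 * (1 - inf_prod p) * B"
    using S_op_contraction[OF assms(1,5,4)] S_op_isometry_defect[OF assms(1,5,4)] by simp_all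
qed

text \<open>(S - l) g = y reads g = (S g - y) / l, and S does not increase the norm, so the
  contraction factor is 1 / |l|.\<close>

lemma invertible_at_large:
  assumes "params d p" "cmod l > 1"
  shows "invertible_at d p l"
proof (rule invertible_at_of_contraction[OF assms(1), of "1 / cmod l" "1 / cmod l"
      "\<lambda>g y x. inverse l * S_op d p g x + (- inverse l) * y x"])
  have l: "l \<noteq> 0" using assms(2) by auto
  fix g y assume gy: "g \<in> C_Gamma d" "y \<in> C_Gamma d"
  show "(\<lambda>x. inverse l * S_op d p g x + (- inverse l) * y x) \<in> C_Gamma d"
    by (intro C_Gamma_lincomb S_op_in_C_Gamma assms(1) gy)
  show "(shifted (S_op d p) l g = y) = ((\<lambda>x. inverse l * S_op d p g x + - inverse l * y x) = g)"
    using l by (auto simp: shifted_def fun_eq_iff field_simps)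
next
  fix g h y z B C x
  assume g: "g \<in> C_Gamma d" "h \<in> C_Gamma d" "\<forall>x\<in>Gamma d. cmod (g x - h x) \<le> B"
    and y: "\<forall>x\<in>Gamma d. cmod (y x - z x) \<le> C" and x: "x \<in> Gamma d"
  have l: "cmod l > 0" using assms(2) by linarith
  have eq: "inverse l * S_op d p g x + - inverse l * y x - (inverse l * S_op d p h x + - inverse l * z x) =
      inverse l * ((S_op d p g x - S_op d p h x) - (y x - z x))"
    by (simp add: algebra_simps)
  have "cmod ((S_op d p g x - S_op d p h x) - (y x - z x)) \<le> B + C"
    using S_op_diff_bound(1)[OF assms(1) g x] y x
      norm_triangle_ineq4[of "S_op d p g x - S_op d p h x" "y x - z x"]
    by force
  then have "inverse (cmod l) * cmod ((S_op d p g x - S_op d p h x) - (y x - z x)) \<le> inverse (cmod l) * (B + C)"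
    using l by (intro mult_left_mono) auto
  then show "cmod (inverse l * S_op d p g x + - inverse l * y x - (inverse l * S_op d p h x + - inverse l * z x))
     \<le> 1 / cmod l * B + 1 / cmod l * C"
    unfolding eq norm_mult norm_inverse by (simp only: divide_inverse ring_distribs mult_1_left)
next
  show "1 / cmod l < 1" using assms(2) by (subst divide_less_eq_1) auto
qed auto

section \<open>Subtraction of 1 with borrow, the inverse of the odometer\<close>

definition predecessor :: "(nat \<Rightarrow> nat) \<Rightarrow> (nat \<Rightarrow> nat) \<Rightarrow> nat \<Rightarrow> nat" where
  "predecessor d x = (\<lambda>r\<in>{1..}.
     if \<forall>k\<in>{1..<r}. x k = 0 then (if x r = 0 then d r - 1 else x r - 1) else x r)"

lemma predecessor_digit: "r \<ge> 1 \<Longrightarrow> predecessor d x r =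
    (if \<forall>k\<in>{1..<r}. x k = 0 then (if x r = 0 then d r - 1 else x r - 1) else x r)"
  by (simp add: predecessor_def)

lemma predecessor_in_Gamma:
  assumes "params d p" "x \<in> Gamma d"
  shows "predecessor d x \<in> Gamma d"
proof (rule GammaI)
  fix r :: nat assume r: "r \<ge> 1"
  have "x r < d r" using Gamma_digit[OF assms(2) r] .
  then show "predecessor d x r < d r" unfolding predecessor_digit[OF r] by auto
qed (simp add: predecessor_def)

lemma agree_predecessor: "agree m x y \<Longrightarrow> agree m (predecessor d x) (predecessor d y)"
  by (auto simp: agree_def predecessor_def)

text \<open>For prefix conditions whose pointwise equivalence is only known while the first one has
  held so far: a digit 0 becomes maximal, and a nonzero digit does not, only as long as the borrow
  reaches it.\<close>

lemma ball_prefix_cong: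
  assumes "\<And>k. k \<ge> 1 \<Longrightarrow> \<forall>j\<in>{1..<k}. P j \<Longrightarrow> P k \<longleftrightarrow> Q k"
  shows "(\<forall>k\<in>{1..<r::nat}. P k) \<longleftrightarrow> (\<forall>k\<in>{1..<r}. Q k)"
proof (induction r)
  case (Suc r)
  show ?case
  proof (cases "r = 0")
    case False
    then have "{1..<Suc r} = insert r {1..<r}" by auto
    then show ?thesis using Suc.IH assms[of r] False by auto
  qed simp
qed simp

text \<open>The carry runs through exactly those digits that the borrow has turned from 0 into the
  maximum.\<close>

lemma successor_predecessor:
  assumes "params d p" "x \<in> Gamma d"
  shows "successor d (predecessor d x) = x"
proof (rule Gamma_eqI)
  let ?u = "predecessor d x"
  show "successor d ?u \<in> Gamma d" by (intro successor_in_Gamma predecessor_in_Gamma[OF assms])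
  fix r :: nat assume r: "r \<ge> 1"
  \<comment> \<open>Oriented by \<open>eq_commute\<close> so that \<open>ball_prefix_cong\<close>
    may assume the borrow condition on the earlier digits of \<open>x\<close>.\<close>
  have iff: "(\<forall>k\<in>{1..<r}. ?u k = d k - 1) \<longleftrightarrow> (\<forall>k\<in>{1..<r}. x k = 0)"
    unfolding eq_commute[of "\<forall>k\<in>{1..<r}. ?u k = d k - 1"]
  proof (rule ball_prefix_cong)
    fix k :: nat assume "k \<ge> 1" "\<forall>j\<in>{1..<k}. x j = 0"
    then show "x k = 0 \<longleftrightarrow> ?u k = d k - 1"
      using Gamma_digit[OF assms(2), of k] by (auto simp: predecessor_digit)
  qed
  define P where "P \<longleftrightarrow> (\<forall>k\<in>{1..<r}. x k = 0)"
  have "x r < d r" "2 \<le> d r" using Gamma_digit[OF assms(2) r] paramsD(1)[OF assms(1) r] .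
  then show "successor d ?u r = x r"
    unfolding successor_digit[OF predecessor_in_Gamma[OF assms] r] iff predecessor_digit[OF r, of d x]
      P_def[symmetric]
    by (cases P; cases "x r = 0") auto
qed (use assms in auto)

lemma predecessor_successor:
  assumes "params d p" "x \<in> Gamma d"
  shows "predecessor d (successor d x) = x"
proof (rule Gamma_eqI)
  let ?u = "successor d x"
  show "predecessor d ?u \<in> Gamma d" by (intro successor_in_Gamma predecessor_in_Gamma[OF assms(1)] assms)
  fix r :: nat assume r: "r \<ge> 1"
  have iff: "(\<forall>k\<in>{1..<r}. ?u k = 0) \<longleftrightarrow> (\<forall>k\<in>{1..<r}. x k = d k - 1)"
    unfolding eq_commute[of "\<forall>k\<in>{1..<r}. ?u k = 0"]
  proof (rule ball_prefix_cong)
    fix k :: nat assume "k \<ge> 1" "\<forall>j\<in>{1..<k}. x j = d j - 1"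
    then show "x k = d k - 1 \<longleftrightarrow> ?u k = 0"
      using paramsD(1)[OF assms(1), of k] successor_digit[OF assms(2), of k] by auto
  qed
  define P where "P \<longleftrightarrow> (\<forall>k\<in>{1..<r}. x k = d k - 1)"
  show "predecessor d ?u r = x r"
    unfolding predecessor_digit[OF r, of d ?u] iff successor_digit[OF assms(2) r] P_def[symmetric]
    by (cases P; cases "x r = d r - 1") auto
qed (use assms in auto)

text \<open>
  The operator is within \<open>2 (1 - inf_prod p)\<close> of the composition with the odometer, which is an
  invertible isometry.
\<close>

lemma invertible_at_small:
  assumes "params d p" "cmod l + 2 * (1 - inf_prod p) < 1"
  shows "invertible_at d p l"
\<comment> \<open>The fixed point equation is (S - l) g = y at \<open>predecessor d x\<close>, with
  \<open>g x\<close> added on both sides. At that point S g is nearly \<open>g x\<close>, so the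
  terms in \<open>g\<close> amount to l g up to the defect.\<close>
proof (rule invertible_at_of_contraction[OF assms(1), of "cmod l + 2 * (1 - inf_prod p)" 1
      "\<lambda>g y x. if x \<in> Gamma d
        then y (predecessor d x) + l * g (predecessor d x) - S_op d p g (predecessor d x) + g x else 0"])
  let ?F = "\<lambda>g y x. if x \<in> Gamma d
        then y (predecessor d x) + l * g (predecessor d x) - S_op d p g (predecessor d x) + g x else 0"
  note pG = predecessor_in_Gamma[OF assms(1)]
  fix g y assume gy: "g \<in> C_Gamma d" "y \<in> C_Gamma d"
  have comp: "(\<lambda>x. if x \<in> Gamma d then h (predecessor d x) else 0) \<in> C_Gamma d" if "h \<in> C_Gamma d" for h
    unfolding C_Gamma_iff
  proof (intro conjI allI impI)
    fix e :: real assume "e > 0"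
    then obtain m where "\<forall>x\<in>Gamma d. \<forall>y\<in>Gamma d. agree m x y \<longrightarrow> cmod (h x - h y) \<le> e"
      using C_GammaD(2)[OF \<open>h \<in> C_Gamma d\<close>] by blast
    then show "\<exists>m. \<forall>x\<in>Gamma d. \<forall>y\<in>Gamma d. agree m x y \<longrightarrow>
        cmod ((if x \<in> Gamma d then h (predecessor d x) else 0) - (if y \<in> Gamma d then h (predecessor d y) else 0)) \<le> e"
      using pG agree_predecessor by (intro exI[of _ m]) simp
  qed simp
  have "?F g y = (\<lambda>x. (if x \<in> Gamma d then y (predecessor d x) - shifted (S_op d p) l g (predecessor d x) else 0) + g x)"
    using C_GammaD(1)[OF gy(1)] by (auto simp: shifted_def fun_eq_iff)
  moreover have "\<dots> \<in> C_Gamma d"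
    by (intro C_Gamma_add comp C_Gamma_diff shifted_in_C_Gamma assms(1) gy)
  ultimately show "?F g y \<in> C_Gamma d" by simp
  show "(shifted (S_op d p) l g = y) = (?F g y = g)"
  proof
    assume "?F g y = g"
    then have eq: "y (predecessor d x) + l * g (predecessor d x) - S_op d p g (predecessor d x) = 0" if "x \<in> Gamma d" for x
      using fun_cong[of "?F g y" g x] that by simp
    show "shifted (S_op d p) l g = y"
    proof (rule C_Gamma_eqI[OF shifted_in_C_Gamma[OF assms(1) gy(1)] gy(2)])
      fix x assume x: "x \<in> Gamma d"
      show "shifted (S_op d p) l g x = y x"
        using eq[OF successor_in_Gamma[OF x]] unfolding predecessor_successor[OF assms(1) x]
        by (simp add: shifted_def algebra_simps)
    qed
  next
    assume "shifted (S_op d p) l g = y"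
    then have "S_op d p g x - l * g x = y x" for x by (simp add: shifted_def fun_eq_iff)
    then have "y x + l * g x - S_op d p g x = 0" for x by (metis diff_add_cancel diff_self)
    then show "?F g y = g" using C_GammaD(1)[OF gy(1)] by (auto simp: fun_eq_iff)
  qed
next
  let ?F = "\<lambda>g y x. if x \<in> Gamma d
        then y (predecessor d x) + l * g (predecessor d x) - S_op d p g (predecessor d x) + g x else 0"
  fix g h y z B C x
  assume g: "g \<in> C_Gamma d" "h \<in> C_Gamma d" "\<forall>x\<in>Gamma d. cmod (g x - h x) \<le> B"
    and y: "\<forall>x\<in>Gamma d. cmod (y x - z x) \<le> C" and x: "x \<in> Gamma d"
  let ?u = "predecessor d x"
  have u: "?u \<in> Gamma d" by (rule predecessor_in_Gamma[OF assms(1) x])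
  let ?E = "(S_op d p g ?u - S_op d p h ?u) - (g x - h x)"
  have "cmod ?E \<le> 2 * (1 - inf_prod p) * B"
    using S_op_diff_bound(2)[OF assms(1) g u] successor_predecessor[OF assms(1) x] by simp
  moreover have "cmod (l * (g ?u - h ?u)) \<le> cmod l * B"
    unfolding norm_mult using g(3) u by (auto intro!: mult_left_mono)
  moreover have "cmod (y ?u - z ?u) \<le> C" using y u by blast
  moreover have eq: "?F g y x - ?F h z x = ((y ?u - z ?u) + l * (g ?u - h ?u)) - ?E"
    using x by (simp add: algebra_simps)
  moreover have "cmod (((y ?u - z ?u) + l * (g ?u - h ?u)) - ?E) \<le> cmod (y ?u - z ?u) + cmod (l * (g ?u - h ?u)) + cmod ?E"
    by (rule order_trans[OF norm_triangle_ineq4]) (intro add_mono norm_triangle_ineq order_refl)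
  ultimately show "cmod (?F g y x - ?F h z x) \<le> (cmod l + 2 * (1 - inf_prod p)) * B + 1 * C"
    unfolding eq distrib_right by linarith
next
  have "inf_prod p \<le> 1" using inf_prod_le_pprod[OF assms(1), of 0] by simp
  then show "0 \<le> cmod l + 2 * (1 - inf_prod p)" by simp
qed (use assms(2) in auto)

section \<open>Reduction to the shifted parameters\<close>

text \<open>The eigenvalue of (S - (1 - p_1)) / p_1 that corresponds to \<open>l\<close>:
  incrementing the first digit multiplies an eigenfunction by it.\<close>

definition iota :: "(nat \<Rightarrow> real) \<Rightarrow> complex \<Rightarrow> complex" where
  "iota p l = (l - of_real (1 - p 1)) / of_real (p 1)"

lemma fib_map_1: "fib_map d p 1 l = iota p l ^ d 1"
  by (simp add: fib_map_def iota_def)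

lemma iota_eq: "p 1 > 0 \<Longrightarrow> l = of_real (1 - p 1) + of_real (p 1) * iota p l"
  by (simp add: iota_def)

lemma fib_in_C_Gamma:
  assumes "g \<in> C_Gamma d" "a < d 1"
  shows "fib d a g \<in> C_Gamma (shift d)"
  unfolding C_Gamma_iff
proof (intro conjI allI impI)
  fix e :: real assume "e > 0"
  then obtain m where m: "\<forall>x\<in>Gamma d. \<forall>y\<in>Gamma d. agree m x y \<longrightarrow> cmod (g x - g y) \<le> e"
    using C_GammaD(2)[OF assms(1)] by blast
  have "cmod (fib d a g u - fib d a g v) \<le> e"
    if "u \<in> Gamma (shift d)" "v \<in> Gamma (shift d)" "agree m u v" for u v
    using that m cons_digit_in_Gamma[of _ d a] assms(2) agree_mono[OF agree_cons_digit[OF that(3)]]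
    by (simp add: fib_def)
  then show "\<exists>m. \<forall>u\<in>Gamma (shift d). \<forall>v\<in>Gamma (shift d). agree m u v \<longrightarrow> cmod (fib d a g u - fib d a g v) \<le> e"
    by blast
qed (simp add: fib_def)

lemma fib_apply: "y \<in> Gamma (shift d) \<Longrightarrow> fib d a g y = g (cons_digit a y)"
  by (simp add: fib_def)

definition glue :: "(nat \<Rightarrow> nat) \<Rightarrow> (nat \<Rightarrow> (nat \<Rightarrow> nat) \<Rightarrow> complex) \<Rightarrow> (nat \<Rightarrow> nat) \<Rightarrow> complex" where
  "glue d G = (\<lambda>x. if x \<in> Gamma d then G (x 1) (tail_digits x) else 0)"

lemma glue_in_C_Gamma:
  assumes "\<And>a. a < d 1 \<Longrightarrow> G a \<in> C_Gamma (shift d)"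
  shows "glue d G \<in> C_Gamma d"
  unfolding C_Gamma_iff
proof (intro conjI allI impI)
  fix e :: real assume "e > 0"
  then have "\<forall>a. \<exists>m. a < d 1 \<longrightarrow> (\<forall>x\<in>Gamma (shift d). \<forall>y\<in>Gamma (shift d). agree m x y \<longrightarrow> cmod (G a x - G a y) \<le> e)"
    using C_GammaD(2)[OF assms] by blast
  then obtain M where M: "\<And>a x y. a < d 1 \<Longrightarrow> x \<in> Gamma (shift d) \<Longrightarrow> y \<in> Gamma (shift d) \<Longrightarrow>
      agree (M a) x y \<Longrightarrow> cmod (G a x - G a y) \<le> e"
    by metis
  \<comment> \<open>A common upper bound for the finitely many fibres; \<open>Suc m\<close> below
    accounts for the first digit.\<close>
  define m where "m = (\<Sum>a<d 1. M a)"
  have m: "M a \<le> m" if "a < d 1" for a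
    unfolding m_def using that by (intro member_le_sum) auto
  have "cmod (glue d G x - glue d G y) \<le> e" if xy: "x \<in> Gamma d" "y \<in> Gamma d" "agree (Suc m) x y" for x y
  proof -
    have "x 1 = y 1" using agree_Suc_1[OF xy(3)] by simp
    moreover have "x 1 < d 1" using Gamma_digit[OF xy(1)] by simp
    moreover have "agree (M (x 1)) (tail_digits x) (tail_digits y)"
      using agree_mono[OF agree_tail_digits[OF xy(3)] m] \<open>x 1 < d 1\<close> by simp
    ultimately show ?thesis
      using M[of "x 1" "tail_digits x" "tail_digits y"] tail_digits_in_Gamma xy(1,2) by (simp add: glue_def)
  qed
  then show "\<exists>m. \<forall>x\<in>Gamma d. \<forall>y\<in>Gamma d. agree m x y \<longrightarrow> cmod (glue d G x - glue d G y) \<le> e"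
    by blast
qed (simp add: glue_def)

lemma glue_cons: "y \<in> Gamma (shift d) \<Longrightarrow> a < d 1 \<Longrightarrow> glue d G (cons_digit a y) = G a y"
  using cons_digit_in_Gamma[of y d a] tail_cons_digit[of y "shift d" a] by (simp add: glue_def)

lemma fib_glue: "a < d 1 \<Longrightarrow> G a \<in> C_Gamma (shift d) \<Longrightarrow> fib d a (glue d G) = G a"
  using C_GammaD(1) by (auto simp: fib_def glue_cons fun_eq_iff)

text \<open>Substituting l = (1 - p_1) + p_1 iota cancels the term of S that stays at the point. The
  same cancellation gives \<open>shifted_carry\<close>.\<close>

lemma shifted_no_carry:
  assumes "params d p" "y \<in> Gamma (shift d)" "Suc a < d 1"
  shows "shifted (S_op d p) l g (cons_digit a y)
    = of_real (p 1) * (g (cons_digit (Suc a) y) - iota p l * g (cons_digit a y))"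
proof -
  let ?x = "cons_digit a y"
  have x: "?x \<in> Gamma d" using cons_digit_in_Gamma[OF assms(2)] assms(3) by simp
  have "S_op d p g ?x = of_real (1 - p 1) * g ?x + of_real (p 1) * g (cons_digit (Suc a) y)"
    using S_op_rec_no_carry[OF assms(1) x, of g] assms(3) tail_cons_digit[OF assms(2)] by simp
  moreover have "l = of_real (1 - p 1) + of_real (p 1) * iota p l"
    using iota_eq params_1[OF assms(1)] by blast
  ultimately show ?thesis
    unfolding shifted_def by (metis (no_types, lifting) add_diff_cancel_left distrib_right mult.assoc right_diff_distrib)
qed

lemma shifted_carry:
  assumes "params d p" "y \<in> Gamma (shift d)" "Suc a = d 1" "g \<in> C_Gamma d"
  shows "shifted (S_op d p) l g (cons_digit a y)
    = of_real (p 1) * (S_op (shift d) (shift p) (fib d 0 g) y - iota p l * g (cons_digit a y))"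
proof -
  let ?x = "cons_digit a y"
  have x: "?x \<in> Gamma d" using cons_digit_in_Gamma[OF assms(2)] assms(3) by simp
  obtain B where "\<forall>y\<in>Gamma d. cmod (g y) \<le> B" using C_Gamma_bounded[OF assms(4)] by blast
  moreover have "?x 1 = d 1 - 1" using assms(3) by simp
  ultimately have "S_op d p g ?x = of_real (1 - p 1) * g ?x
      + of_real (p 1) * S_op (shift d) (shift p) (fib d 0 g) y"
    using S_op_rec_carry[OF assms(1) x, of g B] unfolding tail_cons_digit[OF assms(2)] by blast
  moreover have "l = of_real (1 - p 1) + of_real (p 1) * iota p l"
    using iota_eq params_1[OF assms(1)] by blast
  ultimately show ?thesis
    unfolding shifted_def by (metis (no_types, lifting) add_diff_cancel_left distrib_right mult.assoc right_diff_distrib)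
qed

text \<open>
  The inhomogeneous part of the solution of \<open>(S - l) g = y\<close> on the fibre of first digit \<open>n\<close>;
  the homogeneous part is \<open>iota p l ^ n\<close> times the fibre of first digit \<open>0\<close>.
\<close>

primrec particular ::
    "(nat \<Rightarrow> nat) \<Rightarrow> (nat \<Rightarrow> real) \<Rightarrow> complex \<Rightarrow> ((nat \<Rightarrow> nat) \<Rightarrow> complex) \<Rightarrow> nat \<Rightarrow> (nat \<Rightarrow> nat) \<Rightarrow> complex" where
  "particular d p l y 0 = (\<lambda>u. 0)"
| "particular d p l y (Suc n) = (\<lambda>u. iota p l * particular d p l y n u + inverse (of_real (p 1)) * fib d n y u)"

lemma particular_in_C_Gamma:
  "y \<in> C_Gamma d \<Longrightarrow> n \<le> d 1 \<Longrightarrow> particular d p l y n \<in> C_Gamma (shift d)"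
  by (induction n) (auto intro!: C_Gamma_lincomb C_Gamma_zero fib_in_C_Gamma)

lemma particular_zero: "particular d p l (\<lambda>x. 0) n = (\<lambda>u. 0)"
  by (induction n) (auto simp: fib_def)

lemma particular_bound:
  assumes "Gamma d \<noteq> {}"
  shows "\<exists>K\<ge>0. \<forall>y\<in>C_Gamma d. \<forall>n\<le>d 1. \<forall>u\<in>Gamma (shift d). cmod (particular d p l y n u) \<le> K * sup_norm d y"
proof -
  let ?Q = "\<lambda>n K. K \<ge> 0 \<and> (\<forall>y\<in>C_Gamma d. n \<le> d 1 \<longrightarrow>
    (\<forall>u\<in>Gamma (shift d). cmod (particular d p l y n u) \<le> K * sup_norm d y))"
  have "\<exists>K. ?Q n K" for n
  proof (induction n)
    case 0
    then show ?case by (intro exI[of _ 0]) simp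
  next
    case (Suc n)
    then obtain K where K: "?Q n K" by blast
    let ?K = "cmod (iota p l) * K + inverse \<bar>p 1\<bar>"
    have "cmod (particular d p l y (Suc n) u) \<le> ?K * sup_norm d y"
      if y: "y \<in> C_Gamma d" and n: "Suc n \<le> d 1" and u: "u \<in> Gamma (shift d)" for y u
    proof -
      have "cmod (iota p l * particular d p l y n u) \<le> cmod (iota p l) * (K * sup_norm d y)"
        unfolding norm_mult using K y n u by (intro mult_left_mono) auto
      moreover have "cmod (inverse (of_real (p 1)) * fib d n y u) \<le> inverse \<bar>p 1\<bar> * sup_norm d y"
        unfolding norm_mult norm_inverse norm_of_real fib_apply[OF u]
        using cmod_le_sup_norm[OF y cons_digit_in_Gamma[OF u]] n by (intro mult_left_mono) auto
      ultimately show ?thesis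
        unfolding particular.simps
        by (intro order_trans[OF norm_triangle_ineq]) (simp add: algebra_simps)
    qed
    then have "?Q (Suc n) ?K" using K by simp
    then show ?case by blast
  qed
  then obtain K where K: "\<And>n. ?Q n (K n)" by metis
  define L where "L = (\<Sum>n\<le>d 1. K n)"
  have "cmod (particular d p l y n u) \<le> L * sup_norm d y"
    if y: "y \<in> C_Gamma d" and n: "n \<le> d 1" and u: "u \<in> Gamma (shift d)" for y n u
  proof -
    have "K n \<le> L" unfolding L_def using K n by (intro member_le_sum) auto
    then have "K n * sup_norm d y \<le> L * sup_norm d y"
      using sup_norm_nonneg[OF assms y] by (intro mult_right_mono)
    then show ?thesis using K y n u order_trans by blast
  qed
  moreover have "L \<ge> 0" unfolding L_def using K by (intro sum_nonneg) auto
  ultimately show ?thesis by blast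
qed

text \<open>Without carries the equation is a first-order recursion in the first digit, solved by
  powers of iota plus \<open>particular\<close>. The carry at the last digit closes the recursion
  into a single equation for the fibre of digit 0, in which the powers have accumulated to iota^d_1
  = f_1(l).\<close>

lemma fibre_solution:
  assumes "params d p" "g \<in> C_Gamma d" "y = shifted (S_op d p) l g" "u \<in> Gamma (shift d)"
  shows "a < d 1 \<Longrightarrow> g (cons_digit a u) = iota p l ^ a * fib d 0 g u + particular d p l y a u"
    and "shifted (S_op (shift d) (shift p)) (fib_map d p 1 l) (fib d 0 g) u = particular d p l y (d 1) u"
proof -
  have p1: "of_real (p 1) \<noteq> (0::complex)" using params_1[OF assms(1)] by simp
  show 1: "a < d 1 \<Longrightarrow> g (cons_digit a u) = iota p l ^ a * fib d 0 g u + particular d p l y a u" for a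
  proof (induction a)
    case 0
    then show ?case using fib_apply[OF assms(4)] by simp
  next
    case (Suc a)
    have "y (cons_digit a u) = of_real (p 1) * (g (cons_digit (Suc a) u) - iota p l * g (cons_digit a u))"
      unfolding assms(3) by (rule shifted_no_carry[OF assms(1,4) Suc.prems])
    then have "g (cons_digit (Suc a) u) = iota p l * g (cons_digit a u) + inverse (of_real (p 1)) * fib d a y u"
      using p1 by (simp add: fib_apply[OF assms(4)] field_simps)
    then show ?case using Suc by (simp add: algebra_simps)
  qed
  obtain a where a: "d 1 = Suc a" using params_1[OF assms(1)] by (cases "d 1") auto
  have "y (cons_digit a u) = of_real (p 1) * (S_op (shift d) (shift p) (fib d 0 g) u - iota p l * g (cons_digit a u))"
    unfolding assms(3) by (rule shifted_carry[OF assms(1,4) a[symmetric] assms(2)])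
  then have "S_op (shift d) (shift p) (fib d 0 g) u = iota p l * g (cons_digit a u) + inverse (of_real (p 1)) * fib d a y u"
    using p1 by (simp add: fib_apply[OF assms(4)] field_simps)
  then show "shifted (S_op (shift d) (shift p)) (fib_map d p 1 l) (fib d 0 g) u = particular d p l y (d 1) u"
    using 1[of a] a by (simp add: shifted_def fib_map_1[unfolded One_nat_def] algebra_simps)
qed

text \<open>For the lower bound, the fibre of digit 0 is estimated by the shifted operator and the
  other fibres by \<open>fibre_solution\<close>. For surjectivity, the equation for the fibre of
  digit 0 is solved first and the other fibres are rebuilt by the same formula.\<close>

lemma invertible_at_step:
  assumes "params d p" "invertible_at (shift d) (shift p) (fib_map d p 1 l)"
  shows "invertible_at d p l"
  unfolding invertible_at_def
proof (intro conjI ballI)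
  let ?w = "fib_map d p 1 l" and ?i = "iota p l" and ?d = "shift d" and ?p = "shift p"
  note pos = params_1[OF assms(1)] and par' = params_shift[OF assms(1)]
  note ne = Gamma_nonempty[OF assms(1)] and ne' = Gamma_nonempty[OF par']
  obtain K where K: "K \<ge> 0" "\<And>h. h \<in> C_Gamma ?d \<Longrightarrow> sup_norm ?d h \<le> K * sup_norm ?d (shifted (S_op ?d ?p) ?w h)"
    using assms(2) unfolding invertible_at_def by blast
  obtain L where L: "L \<ge> 0" "\<And>y n u. \<lbrakk>y \<in> C_Gamma d; n \<le> d 1; u \<in> Gamma ?d\<rbrakk> \<Longrightarrow>
      cmod (particular d p l y n u) \<le> L * sup_norm d y"
    using particular_bound[OF ne] by meson
  \<comment> \<open>The 1 inside \<open>max\<close> covers |iota| < 1, where the lowest power is the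
    largest.\<close>
  define M where "M = max 1 (cmod ?i) ^ d 1"
  have M: "cmod (?i ^ a) \<le> M" if "a < d 1" for a
  proof -
    have "cmod (?i ^ a) \<le> max 1 (cmod ?i) ^ a" unfolding norm_power by (intro power_mono) auto
    also have "\<dots> \<le> M" unfolding M_def using that by (intro power_increasing) auto
    finally show ?thesis .
  qed
  have M0: "M \<ge> 0" by (simp add: M_def)
  have "sup_norm d g \<le> (M * (K * L) + L) * sup_norm d (shifted (S_op d p) l g)" if g: "g \<in> C_Gamma d" for g
  proof -
    let ?y = "shifted (S_op d p) l g" and ?h = "fib d 0 g"
    have y: "?y \<in> C_Gamma d" by (rule shifted_in_C_Gamma[OF assms(1) g])
    have h: "?h \<in> C_Gamma ?d" using fib_in_C_Gamma[OF g] pos by simp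
    have "sup_norm ?d (shifted (S_op ?d ?p) ?w ?h) \<le> L * sup_norm d ?y"
      using L(2)[OF y order_refl] fibre_solution(2)[OF assms(1) g refl] by (intro sup_norm_le[OF ne']) simp
    then have "K * sup_norm ?d (shifted (S_op ?d ?p) ?w ?h) \<le> K * (L * sup_norm d ?y)"
      using K(1) by (intro mult_left_mono)
    then have hb: "sup_norm ?d ?h \<le> K * (L * sup_norm d ?y)" using K(2)[OF h] by simp
    have "cmod (g x) \<le> (M * (K * L) + L) * sup_norm d ?y" if x: "x \<in> Gamma d" for x
    proof -
      note u = tail_digits_in_Gamma[OF x]
      have x1: "x 1 < d 1" using Gamma_digit[OF x] by simp
      have gx: "g x = ?i ^ x 1 * ?h (tail_digits x) + particular d p l ?y (x 1) (tail_digits x)"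
        using fibre_solution(1)[OF assms(1) g refl u x1] cons_tail_digits[OF x] by simp
      have "cmod (?h (tail_digits x)) \<le> K * (L * sup_norm d ?y)"
        using cmod_le_sup_norm[OF h u] hb by simp
      then have "cmod (?i ^ x 1 * ?h (tail_digits x)) \<le> M * (K * (L * sup_norm d ?y))"
        unfolding norm_mult using M[OF x1] M0 by (intro mult_mono) auto
      then show ?thesis
        unfolding gx using L(2)[OF y less_imp_le[OF x1] u]
        by (intro order_trans[OF norm_triangle_ineq]) (simp add: algebra_simps)
    qed
    then show ?thesis by (rule sup_norm_le[OF ne])
  qed
  moreover have "M * (K * L) + L \<ge> 0" using M0 K(1) L(1) by simp
  ultimately show "\<exists>K\<ge>0. \<forall>g\<in>C_Gamma d. sup_norm d g \<le> K * sup_norm d (shifted (S_op d p) l g)" by blast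
next
  let ?w = "fib_map d p 1 l" and ?i = "iota p l" and ?d = "shift d" and ?p = "shift p"
  note pos = params_1[OF assms(1)]
  fix y assume y: "y \<in> C_Gamma d"
  let ?R = "particular d p l y"
  \<comment> \<open>By \<open>fibre_solution\<close> this is the equation that the fibre of digit 0
    of any solution must satisfy.\<close>
  obtain h where h: "h \<in> C_Gamma ?d" "shifted (S_op ?d ?p) ?w h = ?R (d 1)"
    using assms(2) particular_in_C_Gamma[OF y order_refl] unfolding invertible_at_def by blast
  define G where "G a = (\<lambda>u. ?i ^ a * h u + 1 * ?R a u)" for a
  have G: "G a \<in> C_Gamma ?d" if "a < d 1" for a
    unfolding G_def using that by (intro C_Gamma_lincomb h particular_in_C_Gamma y) simp
  define g where "g = glue d G"
  have g: "g \<in> C_Gamma d" unfolding g_def by (rule glue_in_C_Gamma[OF G])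
  have gc: "g (cons_digit a u) = G a u" if "u \<in> Gamma ?d" "a < d 1" for a u
    unfolding g_def by (rule glue_cons[OF that])
  have "0 < d 1" using pos by simp
  from fib_glue[of 0 d G, OF this G[OF this]] have g0: "fib d 0 g = h" unfolding g_def by (simp add: G_def)
  have p1: "of_real (p 1) \<noteq> (0::complex)" using pos by simp
  have "shifted (S_op d p) l g = y"
  proof (rule C_Gamma_eqI[OF shifted_in_C_Gamma[OF assms(1) g] y])
    fix x assume x: "x \<in> Gamma d"
    define u a where "u = tail_digits x" and "a = x 1"
    have u: "u \<in> Gamma ?d" unfolding u_def by (rule tail_digits_in_Gamma[OF x])
    have a: "a < d 1" using Gamma_digit[OF x] by (simp add: a_def)
    have xe: "x = cons_digit a u" using cons_tail_digits[OF x] by (simp add: a_def u_def)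
    show "shifted (S_op d p) l g x = y x"
    proof (cases "Suc a < d 1")
      case True
      have "shifted (S_op d p) l g x = of_real (p 1) * (G (Suc a) u - ?i * G a u)"
        unfolding xe shifted_no_carry[OF assms(1) u True] gc[OF u a] gc[OF u True] ..
      also have "G (Suc a) u - ?i * G a u = inverse (of_real (p 1)) * y x"
        by (simp add: G_def fib_apply[OF u] xe algebra_simps)
      finally show ?thesis using p1 by simp
    next
      case False
      then have da: "Suc a = d 1" using a by simp
      have "S_op ?d ?p h u = ?w * h u + ?R (d 1) u"
        using fun_cong[OF h(2), of u] by (simp add: shifted_def algebra_simps)
      then have "shifted (S_op d p) l g x = of_real (p 1) * (?w * h u + ?R (d 1) u - ?i * G a u)"
        unfolding xe shifted_carry[OF assms(1) u da g] g0 gc[OF u a] by simp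
      also have "?w * h u + ?R (d 1) u - ?i * G a u = inverse (of_real (p 1)) * y x"
        unfolding fib_map_1 da[symmetric] by (simp add: G_def fib_apply[OF u] xe algebra_simps)
      finally show ?thesis using p1 by simp
    qed
  qed
  then show "\<exists>g\<in>C_Gamma d. shifted (S_op d p) l g = y" using g by blast
qed

section \<open>Iterating the reduction\<close>

lemma fib_map_shift: "fib_map (shift d) (shift p) r z = fib_map d p (Suc r) z"
  by (simp add: fib_map_def)

lemma fib_iter_shift: "fib_iter d p (Suc r) z = fib_iter (shift d) (shift p) r (fib_map d p 1 z)"
proof (induction r)
  case (Suc r)
  have "fib_iter d p (Suc (Suc r)) z = fib_map d p (Suc (Suc r)) (fib_iter d p (Suc r) z)"
    by (rule fib_iter.simps(2))
  then show ?case unfolding Suc by (simp only: fib_iter.simps(2) fib_map_shift)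
qed simp

lemma shift_funpow: "(shift ^^ r) f n = f (n + r)"
  by (induction r arbitrary: n) simp_all

lemma params_funpow: "params d p \<Longrightarrow> params ((shift ^^ r) d) ((shift ^^ r) p)"
  by (induction r) (simp_all add: params_shift)

lemma invertible_at_iter:
  "params d p \<Longrightarrow> invertible_at ((shift ^^ r) d) ((shift ^^ r) p) (fib_iter d p r l) \<Longrightarrow> invertible_at d p l"
proof (induction r arbitrary: d p l)
  case (Suc r)
  have "invertible_at (shift d) (shift p) (fib_map d p 1 l)"
    using Suc.prems(2) unfolding funpow_Suc_right o_apply fib_iter_shift
    by (rule Suc.IH[OF params_shift[OF Suc.prems(1)]])
  then show ?case by (rule invertible_at_step[OF Suc.prems(1)])
qed simp

section \<open>Eigenfunctions\<close>

primrec eig ::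
    "nat \<Rightarrow> (nat \<Rightarrow> nat) \<Rightarrow> (nat \<Rightarrow> real) \<Rightarrow> complex \<Rightarrow> (nat \<Rightarrow> nat) \<Rightarrow> complex" where
  "eig 0 d p l = (\<lambda>x. if x \<in> Gamma d then 1 else 0)"
| "eig (Suc m) d p l =
    glue d (\<lambda>a u. iota p l ^ a * eig m (shift d) (shift p) (fib_map d p 1 l) u)"

lemma eig_in_C_Gamma: "eig m d p l \<in> C_Gamma d"
proof (induction m arbitrary: d p l)
  case (Suc m)
  show ?case unfolding eig.simps by (intro glue_in_C_Gamma C_Gamma_cmult Suc)
qed (simp add: C_Gamma_const)

lemma eig_zeros: "params d p \<Longrightarrow> eig m d p l zeros = 1"
proof (induction m arbitrary: d p l)
  case 0
  then show ?case by (simp add: zeros_in_Gamma)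
next
  case (Suc m)
  have "zeros 1 = 0" by (simp add: zeros_def)
  then show ?case
    unfolding eig.simps glue_def tail_zeros Suc.IH[OF params_shift[OF Suc.prems]]
    using zeros_in_Gamma[OF Suc.prems] by simp
qed

text \<open>Off a carry there is no error. A carry hands the error to the shifted parameters with a
  factor p_1, and after \<open>m\<close> carries the constant 1 is left, whose error is 1 - w_m
  because S fixes constants.\<close>

lemma shifted_eig_bound:
  assumes "params d p" "x \<in> Gamma d"
  shows "cmod (shifted (S_op d p) l (eig m d p l) x) \<le> pprod p m * cmod (fib_iter d p m l - 1)"
  using assms
proof (induction m arbitrary: d p l x)
  case 0
  \<comment> \<open>The indicator of \<open>Gamma d\<close> and the constant 1 differ only outside
    \<open>Gamma d\<close>; \<open>S_op_contraction\<close> with bound 0 shows that S does not see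
    the difference.\<close>
  have "S_op d p (\<lambda>x. if x \<in> Gamma d then 1 else 0) x = 1"
  proof -
    have "S_op d p (\<lambda>x. if x \<in> Gamma d then 1 else 0) x = S_op d p (\<lambda>x. 1) x"
      using S_op_diff[OF "0.prems", of "\<lambda>x. if x \<in> Gamma d then 1 else 0" 1 "\<lambda>x. 1" 1]
        S_op_contraction[OF "0.prems", of "\<lambda>y. (if y \<in> Gamma d then 1 else 0) - 1" 0] by simp
    then show ?thesis using S_op_const[OF "0.prems"] by simp
  qed
  then show ?case using "0.prems" by (simp add: shifted_def norm_minus_commute)
next
  case (Suc m)
  let ?h = "eig m (shift d) (shift p) (fib_map d p 1 l)" and ?i = "iota p l"
  let ?g = "eig (Suc m) d p l"
  note par = Suc.prems(1)
  note pos = params_1[OF par]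
  have g: "?g \<in> C_Gamma d" by (rule eig_in_C_Gamma)
  define u a where "u = tail_digits x" and "a = x 1"
  have u: "u \<in> Gamma (shift d)" unfolding u_def by (rule tail_digits_in_Gamma[OF Suc.prems(2)])
  have a: "a < d 1" using Gamma_digit[OF Suc.prems(2)] by (simp add: a_def)
  have xe: "x = cons_digit a u" using cons_tail_digits[OF Suc.prems(2)] by (simp add: a_def u_def)
  have gc: "?g (cons_digit b u) = ?i ^ b * ?h u" if "b < d 1" for b
    unfolding eig.simps using glue_cons[OF u that] by simp
  have rhs: "0 \<le> pprod p (Suc m) * cmod (fib_iter d p (Suc m) l - 1)"
    using pprod_pos[OF par] by (simp add: less_imp_le)
  show ?case
  proof (cases "Suc a < d 1")
    case True
    have "shifted (S_op d p) l ?g x = of_real (p 1) * (?i ^ Suc a * ?h u - ?i * (?i ^ a * ?h u))"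
      unfolding xe shifted_no_carry[OF par u True] gc[OF a] gc[OF True] ..
    then have "shifted (S_op d p) l ?g x = 0" by simp
    then show ?thesis using rhs by simp
  next
    case False
    then have da: "Suc a = d 1" using a by simp
    have "fib d 0 ?g = ?h"
      unfolding eig.simps using pos
      by (subst fib_glue) (auto intro!: C_Gamma_cmult eig_in_C_Gamma)
    then have "shifted (S_op d p) l ?g x = of_real (p 1) * (S_op (shift d) (shift p) ?h u - ?i * (?i ^ a * ?h u))"
      unfolding xe shifted_carry[OF par u da g] gc[OF a] by simp
    also have "\<dots> = of_real (p 1) * shifted (S_op (shift d) (shift p)) (fib_map d p 1 l) ?h u"
      by (simp only: shifted_def fib_map_1 da[symmetric] power_Suc mult.assoc)
    finally have "cmod (shifted (S_op d p) l ?g x) =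
        p 1 * cmod (shifted (S_op (shift d) (shift p)) (fib_map d p 1 l) ?h u)"
      using pos by (simp add: norm_mult)
    also have "\<dots> \<le> p 1 * (pprod (shift p) m * cmod (fib_iter (shift d) (shift p) m (fib_map d p 1 l) - 1))"
      by (rule mult_left_mono[OF Suc.IH[OF params_shift[OF par] u]]) (use pos in simp)
    finally show ?thesis unfolding fib_iter_shift pprod_shift by (simp only: mult.assoc)
  qed
qed

lemma preimage_eigenvalue:
  assumes "params d p" "fib_iter d p m l = 1"
  shows "\<exists>g\<in>C_Gamma d. g \<noteq> (\<lambda>x. 0) \<and> shifted (S_op d p) l g = (\<lambda>x. 0)"
proof (intro bexI conjI)
  let ?g = "eig m d p l"
  show "?g \<noteq> (\<lambda>x. 0)" using eig_zeros[OF assms(1), of m l] by auto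
  show "shifted (S_op d p) l ?g = (\<lambda>x. 0)"
    using shifted_eig_bound[OF assms(1), of _ l m] assms(2)
    by (intro C_Gamma_eqI[OF shifted_in_C_Gamma[OF assms(1)] C_Gamma_zero]) (auto intro: eig_in_C_Gamma)
qed (rule eig_in_C_Gamma)

text \<open>An eigenfunction g of a nearby eigenvalue z satisfies (S - l) g = (z - l) g.\<close>

lemma closure_preimages_approx_spectrum:
  assumes "params d p" "l \<in> closure (\<Union>r\<in>{1..}. fib_iter d p r -` {1})"
  shows "l \<in> approx_spectrum_on (C_Gamma d) (sup_norm d) (S_op d p)"
  unfolding approx_spectrum_iff[OF assms(1)]
proof (intro allI impI)
  fix e :: real assume "e > 0"
  then obtain z m where z: "fib_iter d p m z = 1" "dist z l < e"
    using assms(2) unfolding closure_approachable by auto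
  obtain g where g: "g \<in> C_Gamma d" "g \<noteq> (\<lambda>x. 0)" "shifted (S_op d p) z g = (\<lambda>x. 0)"
    using preimage_eigenvalue[OF assms(1) z(1)] by blast
  have "shifted (S_op d p) l g = (\<lambda>x. (z - l) * g x)"
  proof
    fix x show "shifted (S_op d p) l g x = (z - l) * g x"
      using fun_cong[OF g(3), of x] by (simp add: shifted_def algebra_simps)
  qed
  then have "sup_norm d (shifted (S_op d p) l g) = cmod (z - l) * sup_norm d g"
    using sup_norm_cmult[OF Gamma_nonempty[OF assms(1)] g(1)] by simp
  also have "\<dots> \<le> e * sup_norm d g"
    using z(2) sup_norm_nonneg[OF Gamma_nonempty[OF assms(1)] g(1)]
    by (intro mult_right_mono) (auto simp: dist_norm)
  finally show "\<exists>g\<in>C_Gamma d. g \<noteq> (\<lambda>x. 0) \<and> sup_norm d (shifted (S_op d p) l g) \<le> e * sup_norm d g"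
    using g by blast
qed

lemma approx_spectrum_of_vanishing_product:
  assumes "params d p" "inf_prod p = 0" "\<And>r. cmod (fib_iter d p r l) \<le> 1"
  shows "l \<in> approx_spectrum_on (C_Gamma d) (sup_norm d) (S_op d p)"
  unfolding approx_spectrum_iff[OF assms(1)]
proof (intro allI impI)
  fix e :: real assume "e > 0"
  then have "\<forall>\<^sub>F m in sequentially. pprod p m < e / 2"
    using pprod_tendsto[OF assms(1)] assms(2) by (intro order_tendstoD(2)) auto
  then obtain m where m: "pprod p m < e / 2" by (auto simp: eventually_sequentially)
  let ?g = "eig m d p l"
  have g: "?g \<in> C_Gamma d" by (rule eig_in_C_Gamma)
  have "cmod (fib_iter d p m l - 1) \<le> 2"
    using norm_triangle_ineq4[of "fib_iter d p m l" 1] assms(3)[of m] by simp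
  then have "pprod p m * cmod (fib_iter d p m l - 1) \<le> (e / 2) * 2"
    using m pprod_pos[OF assms(1), of m] by (intro mult_mono) auto
  then have "sup_norm d (shifted (S_op d p) l ?g) \<le> e"
    using order_trans[OF shifted_eig_bound[OF assms(1)]] by (intro sup_norm_le[OF Gamma_nonempty[OF assms(1)]]) auto
  moreover have "1 \<le> sup_norm d ?g"
    using cmod_le_sup_norm[OF g zeros_in_Gamma[OF assms(1)]] eig_zeros[OF assms(1)] by simp
  then have "e * 1 \<le> e * sup_norm d ?g" using \<open>e > 0\<close> by (intro mult_left_mono) auto
  moreover have "?g \<noteq> (\<lambda>x. 0)" using eig_zeros[OF assms(1), of m l] by auto
  ultimately show "\<exists>g\<in>C_Gamma d. g \<noteq> (\<lambda>x. 0) \<and> sup_norm d (shifted (S_op d p) l g) \<le> e * sup_norm d g"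
    using g by force
qed

section \<open>Every eigenvalue is an iterated preimage of 1\<close>

lemma eigenfunction_fibres:
  assumes "params d p" "g \<in> C_Gamma d" "shifted (S_op d p) l g = (\<lambda>x. 0)"
  shows "u \<in> Gamma (shift d) \<Longrightarrow> a < d 1 \<Longrightarrow> g (cons_digit a u) = iota p l ^ a * fib d 0 g u"
    and "shifted (S_op (shift d) (shift p)) (fib_map d p 1 l) (fib d 0 g) = (\<lambda>x. 0)"
    and "fib d 0 g \<in> C_Gamma (shift d)"
    and "fib d 0 g zeros = g zeros"
proof -
  note sol = fibre_solution[OF assms(1,2) assms(3)[symmetric]]
  show "u \<in> Gamma (shift d) \<Longrightarrow> a < d 1 \<Longrightarrow> g (cons_digit a u) = iota p l ^ a * fib d 0 g u"
    using sol(1) by (simp add: particular_zero)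
  show h: "fib d 0 g \<in> C_Gamma (shift d)" using fib_in_C_Gamma[OF assms(2)] params_1[OF assms(1)] by simp
  show "shifted (S_op (shift d) (shift p)) (fib_map d p 1 l) (fib d 0 g) = (\<lambda>x. 0)"
    using sol(2)
    by (intro C_Gamma_eqI[OF shifted_in_C_Gamma[OF params_shift[OF assms(1)] h] C_Gamma_zero])
       (simp add: particular_zero)
  show "fib d 0 g zeros = g zeros"
    using fib_apply[OF zeros_in_Gamma[OF params_shift[OF assms(1)]]] by (simp add: cons_zeros)
qed

text \<open>Changing a first digit from 0 to a multiplies an eigenfunction by iota^a, and its fibre
  of digit 0 is again an eigenfunction. So the value at a point with finitely many nonzero digits is
  a multiple of the value at \<open>zeros\<close>.\<close>

lemma eigenfunction_zero_finite:
  assumes "params d p" "g \<in> C_Gamma d" "shifted (S_op d p) l g = (\<lambda>x. 0)" "g zeros = 0"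
    and "x \<in> Gamma d" "\<And>r. r > m \<Longrightarrow> x r = 0"
  shows "g x = 0"
  using assms
proof (induction m arbitrary: d p g l x)
  case 0
  have "x = zeros"
    by (rule Gamma_eqI[OF "0.prems"(5) zeros_in_Gamma[OF "0.prems"(1)]]) (use 0 in \<open>auto simp: zeros_def\<close>)
  then show ?case using 0 by simp
next
  case (Suc m)
  note fibs = eigenfunction_fibres[OF Suc.prems(1-3)]
  have "fib d 0 g (tail_digits x) = 0"
  proof (rule Suc.IH[OF params_shift[OF Suc.prems(1)] fibs(3,2) _ tail_digits_in_Gamma[OF Suc.prems(5)]])
    show "fib d 0 g zeros = 0" using fibs(4) Suc.prems(4) by simp
    show "tail_digits x r = 0" if "r > m" for r
      using Suc.prems(6)[of "Suc r"] that by (simp add: tail_digits_def)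
  qed
  then show ?case
    using fibs(1)[OF tail_digits_in_Gamma[OF Suc.prems(5)], of "x 1"] Gamma_digit[OF Suc.prems(5), of 1]
      cons_tail_digits[OF Suc.prems(5)] by simp
qed

text \<open>Points with finitely many nonzero digits are dense, so an eigenfunction vanishing at
  \<open>zeros\<close> vanishes everywhere. This permits the normalisation to 1 at
  \<open>zeros\<close>.\<close>

lemma eigenfunction_zeros_nonzero:
  assumes "params d p" "g \<in> C_Gamma d" "shifted (S_op d p) l g = (\<lambda>x. 0)" "g \<noteq> (\<lambda>x. 0)"
  shows "g zeros \<noteq> 0"
proof
  assume z: "g zeros = 0"
  have "g x = 0" if x: "x \<in> Gamma d" for x
  proof -
    have "cmod (g x) \<le> e" if e: "e > 0" for e
    proof -
      obtain m where m: "\<forall>x\<in>Gamma d. \<forall>y\<in>Gamma d. agree m x y \<longrightarrow> cmod (g x - g y) \<le> e"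
        using C_GammaD(2)[OF assms(2) e] by blast
      define t where "t = (\<lambda>r\<in>{1..}. if r \<le> m then x r else 0)"
      have t: "t \<in> Gamma d"
      proof (rule GammaI)
        fix r :: nat assume r: "r \<ge> 1"
        show "t r < d r" using Gamma_digit[OF x r] r by (cases "r \<le> m") (simp_all add: t_def)
      qed (simp add: t_def)
      have "g t = 0"
        by (rule eigenfunction_zero_finite[OF assms(1-3) z t, of m]) (simp add: t_def)
      moreover have "agree m x t" by (simp add: agree_def t_def)
      ultimately have "cmod (g x - 0) \<le> e" using m x t by metis
      then show ?thesis by simp
    qed
    then have "cmod (g x) \<le> 0" by (rule field_le_epsilon) simp
    then show ?thesis by simp
  qed
  then have "g = (\<lambda>x. 0)" by (intro C_Gamma_eqI[OF assms(2) C_Gamma_zero]) auto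
  then show False using assms(4) by simp
qed

text \<open>
  If the eigenfunction oscillates little then all powers \<open>iota p l ^ a\<close>, \<open>a < d 1\<close>, are close to \<open>1\<close>,
  so the distance to the repelling fixed point \<open>1\<close> grows by a factor of at least \<open>3/2\<close>.
\<close>

lemma eigenvalue_repelled:
  assumes "params d p" "g \<in> C_Gamma d" "shifted (S_op d p) l g = (\<lambda>x. 0)" "g zeros = 1"
    and "\<forall>x\<in>Gamma d. \<forall>y\<in>Gamma d. cmod (g x - g y) \<le> 1 / 4"
  shows "cmod (l - 1) \<le> (2 / 3) ^ n"
  using assms
proof (induction n arbitrary: d p g l)
  \<comment> \<open>With the normalisation \<open>g zeros = 1\<close>, the power iota^a is itself a
    value of \<open>g\<close>.\<close>
  have iota_near: "cmod (iota p l ^ a - 1) \<le> 1 / 4"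
    if prems: "params d p" "g \<in> C_Gamma d" "shifted (S_op d p) l g = (\<lambda>x. 0)" "g zeros = 1"
      "\<forall>x\<in>Gamma d. \<forall>y\<in>Gamma d. cmod (g x - g y) \<le> 1 / 4" and a: "a < d 1" for d p g l a
  proof -
    note fibs = eigenfunction_fibres[OF prems(1-3)]
    note z' = zeros_in_Gamma[OF params_shift[OF prems(1)]]
    have "g (cons_digit a zeros) = iota p l ^ a" using fibs(1)[OF z' a] fibs(4) prems(4) by simp
    then show ?thesis
      using prems(5) cons_digit_in_Gamma[OF z' a] zeros_in_Gamma[OF prems(1)] prems(4) by metis
  qed
  have le_iota: "cmod (l - 1) \<le> cmod (iota p l - 1)" if "params d p" for d p l
  proof -
    have "l - 1 = of_real (p 1) * (iota p l - 1)"
      using params_1[OF that] by (simp add: iota_def field_simps)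
    then have "cmod (l - 1) = p 1 * cmod (iota p l - 1)" using params_1[OF that] by (simp add: norm_mult)
    also have "\<dots> \<le> 1 * cmod (iota p l - 1)" using params_1[OF that] by (intro mult_right_mono) auto
    finally show ?thesis by simp
  qed
  {
    case 0
    have "cmod (iota p l - 1) \<le> 1 / 4" using iota_near[OF 0, of 1] params_1[OF 0(1)] by simp
    then show ?case using le_iota[OF 0(1), of l] by simp
  next
    case (Suc n)
    note prems = Suc.prems
    note fibs = eigenfunction_fibres[OF prems(1-3)]
    let ?i = "iota p l" and ?w = "fib_map d p 1 l"
    have z0: "cons_digit 0 u \<in> Gamma d" if "u \<in> Gamma (shift d)" for u
      using cons_digit_in_Gamma[OF that] params_1[OF prems(1)] by simp
    have IH: "cmod (?w - 1) \<le> (2 / 3) ^ n"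
      by (rule Suc.IH[OF params_shift[OF prems(1)] fibs(3,2)])
         (use fibs(4) prems(4,5) z0 in \<open>auto simp: fib_def simp del: shift_apply\<close>)
    \<comment> \<open>Each of the d_1 >= 2 summands is within 1/4 of 1, so the sum has modulus at
      least (3/4) d_1 >= 3/2.\<close>
    have "cmod ((\<Sum>a<d 1. ?i ^ a) - of_nat (d 1)) \<le> real (d 1) * (1 / 4)"
    proof -
      have "(\<Sum>a<d 1. ?i ^ a) - of_nat (d 1) = (\<Sum>a<d 1. ?i ^ a - 1)" by (simp add: sum_subtractf)
      also have "cmod \<dots> \<le> real (card {..<d 1}) * (1 / 4)"
        by (rule sum_norm_bound) (use iota_near[OF prems] in auto)
      finally show ?thesis by simp
    qed
    then have "cmod (of_nat (d 1) :: complex) - cmod (\<Sum>a<d 1. ?i ^ a) \<le> real (d 1) * (1 / 4)"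
      using norm_triangle_ineq2[of "of_nat (d 1) :: complex" "\<Sum>a<d 1. ?i ^ a"] by (simp add: norm_minus_commute)
    then have big: "3 / 2 \<le> cmod (\<Sum>a<d 1. ?i ^ a)" using params_1(1)[OF prems(1)] by simp
    have "?w - 1 = (?i - 1) * (\<Sum>a<d 1. ?i ^ a)"
      unfolding fib_map_1 by (rule power_diff_1_eq)
    then have "cmod (?w - 1) = cmod (?i - 1) * cmod (\<Sum>a<d 1. ?i ^ a)" by (simp add: norm_mult)
    then have "cmod (?i - 1) * (3 / 2) \<le> cmod (?w - 1)"
      using mult_left_mono[OF big norm_ge_zero[of "?i - 1"]] by argo
    then show ?case using IH le_iota[OF prems(1), of l] by simp
  }
qed

text \<open>Each passage to the fibre of digit 0 shortens by one the prefix needed for oscillation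
  at most 1/4. After \<open>m\<close> passages no prefix is left, and
  \<open>eigenvalue_repelled\<close> for all \<open>n\<close> forces the eigenvalue reached, w_m, to
  be 1.\<close>

lemma eigenvalue_preimage_aux:
  assumes "params d p" "g \<in> C_Gamma d" "shifted (S_op d p) l g = (\<lambda>x. 0)" "g zeros = 1"
    and "\<forall>x\<in>Gamma d. \<forall>y\<in>Gamma d. agree m x y \<longrightarrow> cmod (g x - g y) \<le> 1 / 4"
  shows "fib_iter d p m l = 1"
  using assms
proof (induction m arbitrary: d p g l)
  case 0
  have "cmod (l - 1) \<le> (2 / 3) ^ n" for n
    by (rule eigenvalue_repelled[OF "0.prems"(1-4)]) (use "0.prems"(5) in \<open>auto simp: agree_def\<close>)
  moreover have "(\<lambda>n. (2 / 3 :: real) ^ n) \<longlonglongrightarrow> 0" by (rule LIMSEQ_realpow_zero) auto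
  ultimately have "cmod (l - 1) \<le> 0" by (intro LIMSEQ_le_const[where X = "\<lambda>n. (2 / 3 :: real) ^ n"]) auto
  then show ?case by simp
next
  case (Suc m)
  note fibs = eigenfunction_fibres[OF Suc.prems(1-3)]
  have z0: "cons_digit 0 u \<in> Gamma d" if "u \<in> Gamma (shift d)" for u
    using cons_digit_in_Gamma[OF that] params_1[OF Suc.prems(1)] by simp
  have "fib_iter (shift d) (shift p) m (fib_map d p 1 l) = 1"
    by (rule Suc.IH[OF params_shift[OF Suc.prems(1)] fibs(3,2)])
       (use fibs(4) Suc.prems(4,5) z0 agree_cons_digit in \<open>auto simp: fib_def simp del: shift_apply\<close>)
  then show ?case unfolding fib_iter_shift .
qed

lemma eigenvalue_preimage:
  assumes "params d p" "g \<in> C_Gamma d" "shifted (S_op d p) l g = (\<lambda>x. 0)" "g \<noteq> (\<lambda>x. 0)"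
  shows "\<exists>r\<ge>1. fib_iter d p r l = 1"
proof -
  let ?c = "inverse (g zeros)"
  have nz: "g zeros \<noteq> 0" by (rule eigenfunction_zeros_nonzero[OF assms])
  define h where "h = (\<lambda>x. ?c * g x)"
  have h: "h \<in> C_Gamma d" unfolding h_def by (rule C_Gamma_cmult[OF assms(2)])
  have "shifted (S_op d p) l h = (\<lambda>x. 0)"
    using shifted_lincomb[OF assms(1,2,2), of l ?c 0] assms(3) by (simp add: h_def)
  moreover have "h zeros = 1" using nz by (simp add: h_def)
  moreover obtain m where "\<forall>x\<in>Gamma d. \<forall>y\<in>Gamma d. agree m x y \<longrightarrow> cmod (h x - h y) \<le> 1 / 4"
    using C_GammaD(2)[OF h, of "1 / 4"] by auto
  \<comment> \<open>One digit more than necessary, because the index of the preimage must be at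
    least 1.\<close>
  then have "\<forall>x\<in>Gamma d. \<forall>y\<in>Gamma d. agree (Suc m) x y \<longrightarrow> cmod (h x - h y) \<le> 1 / 4"
    using agree_mono le_SucI by blast
  ultimately have "fib_iter d p (Suc m) l = 1" by (rule eigenvalue_preimage_aux[OF assms(1) h])
  then show ?thesis by (intro exI[of _ "Suc m"]) simp
qed

lemma point_spectrum_eq:
  assumes "params d p"
  shows "point_spectrum_on (C_Gamma d) (S_op d p) = (\<Union>r\<in>{1..}. fib_iter d p r -` {1})"
proof -
  have eigen: "S_op d p g = (\<lambda>x. l * g x) \<longleftrightarrow> shifted (S_op d p) l g = (\<lambda>x. 0)" for g l
    by (simp add: shifted_def fun_eq_iff)
  show ?thesis
    unfolding point_spectrum_on_def eigen
    using eigenvalue_preimage[OF assms] preimage_eigenvalue[OF assms] by fastforce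
qed

section \<open>The fibered filled Julia set\<close>

text \<open>The affine part does not decrease the modulus outside the open unit disc, since |z| - (1
  - p_r) is at least p_r |z| there; the exponent d_r >= 2 then at least squares it.\<close>

lemma fib_map_growth:
  assumes "params d p" "r \<ge> 1" "1 \<le> cmod z"
  shows "cmod z ^ 2 \<le> cmod (fib_map d p r z)"
proof -
  note pr = paramsD[OF assms(1,2)]
  have "cmod z \<le> cmod (z - of_real (1 - p r)) + cmod (of_real (1 - p r) :: complex)"
    by (metis diff_add_cancel norm_triangle_ineq)
  also have "cmod (of_real (1 - p r) :: complex) = 1 - p r"
    unfolding norm_of_real using pr by simp
  finally have "cmod z - (1 - p r) \<le> cmod (z - of_real (1 - p r))" by simp
  moreover have "p r * (cmod z - 1) \<le> 1 * (cmod z - 1)"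
    using pr assms(3) by (intro mult_right_mono) auto
  ultimately have "p r * cmod z \<le> cmod (z - of_real (1 - p r))" by (simp add: algebra_simps)
  then have le: "cmod z \<le> cmod ((z - of_real (1 - p r)) / of_real (p r))"
    using pr by (simp add: norm_divide field_simps)
  then have "cmod z ^ 2 \<le> cmod ((z - of_real (1 - p r)) / of_real (p r)) ^ 2"
    by (intro power_mono) auto
  also have "\<dots> \<le> cmod ((z - of_real (1 - p r)) / of_real (p r)) ^ d r"
    using pr le assms(3) by (intro power_increasing) auto
  finally show ?thesis by (simp only: fib_map_def norm_power)
qed

lemma fib_iter_growth:
  assumes "params d p" "1 \<le> q" "q \<le> cmod (fib_iter d p r z)"
  shows "q ^ Suc k \<le> cmod (fib_iter d p (r + k) z)"
proof (induction k)
  case (Suc k)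
  have "q ^ Suc (Suc k) \<le> (q ^ Suc k) ^ 2"
    unfolding power_mult[symmetric] using assms(2) by (intro power_increasing) auto
  also have "\<dots> \<le> cmod (fib_iter d p (r + k) z) ^ 2"
    using Suc assms(2) by (intro power_mono) auto
  also have "\<dots> \<le> cmod (fib_map d p (Suc (r + k)) (fib_iter d p (r + k) z))"
    using Suc one_le_power[OF assms(2), of "Suc k"] by (intro fib_map_growth[OF assms(1)]) auto
  finally show ?case by simp
qed (use assms in simp)

lemma fib_iter_escape:
  assumes "params d p" "1 < cmod (fib_iter d p r z)"
  shows "\<exists>k\<ge>n. B < cmod (fib_iter d p k z)"
proof -
  let ?q = "cmod (fib_iter d p r z)"
  obtain k where k: "B < ?q ^ k" using real_arch_pow[OF assms(2)] by blast
  have "?q ^ k \<le> ?q ^ Suc (k + n)" using assms(2) by (intro power_increasing) auto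
  also have "\<dots> \<le> cmod (fib_iter d p (r + (k + n)) z)"
    using assms(2) by (intro fib_iter_growth[OF assms(1)]) auto
  finally have "B < cmod (fib_iter d p (r + (k + n)) z)" using k by simp
  then show ?thesis by (intro exI[of _ "r + (k + n)"]) auto
qed

text \<open>An orbit that leaves the closed unit disc once is unbounded by
  \<open>fib_iter_escape\<close>, so every bounded orbit is bounded by 1.\<close>

lemma filled_julia_iff:
  assumes "params d p"
  shows "z \<in> filled_julia d p \<longleftrightarrow> (\<forall>r. cmod (fib_iter d p r z) \<le> 1)"
proof
  assume "z \<in> filled_julia d p"
  then have lim: "limsup (\<lambda>r. ereal (cmod (fib_iter d p r z))) < \<infinity>" by (simp add: filled_julia_def)
  then obtain B :: nat where "limsup (\<lambda>r. ereal (cmod (fib_iter d p r z))) < ereal (real B)"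
    using less_PInf_Ex_of_nat by auto
  then have "\<forall>\<^sub>F r in sequentially. ereal (cmod (fib_iter d p r z)) < ereal (real B)" by (rule Limsup_lessD)
  then obtain n where n: "\<And>r. r \<ge> n \<Longrightarrow> cmod (fib_iter d p r z) < real B"
    by (auto simp: eventually_sequentially)
  show "\<forall>r. cmod (fib_iter d p r z) \<le> 1"
  proof (rule ccontr)
    assume "\<not> (\<forall>r. cmod (fib_iter d p r z) \<le> 1)"
    then obtain r where "1 < cmod (fib_iter d p r z)" by (auto simp: not_le)
    from fib_iter_escape[OF assms this, of n "real B"] n show False by force
  qed
next
  assume "\<forall>r. cmod (fib_iter d p r z) \<le> 1"
  then have "limsup (\<lambda>r. ereal (cmod (fib_iter d p r z))) \<le> 1"
    by (intro Limsup_bounded) (auto simp: one_ereal_def)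
  then show "z \<in> filled_julia d p" by (auto simp: filled_julia_def)
qed

section \<open>The iterates as holomorphic maps, and the boundary of the Julia set\<close>

lemma fib_iter_holomorphic: "fib_iter d p r holomorphic_on UNIV"
proof (induction r)
  case 0
  have "fib_iter d p 0 = (\<lambda>z. z)" by (simp add: fun_eq_iff)
  then show ?case by (simp add: holomorphic_on_ident)
next
  case (Suc r)
  have "fib_iter d p (Suc r) =
      (\<lambda>z. (inverse (of_real (p (Suc r))) * (fib_iter d p r z - of_real (1 - p (Suc r)))) ^ d (Suc r))"
    by (simp add: fun_eq_iff fib_map_def divide_inverse mult.commute)
  then show ?case using Suc by (auto intro!: holomorphic_intros)
qed

lemma fib_iter_holomorphic_on: "fib_iter d p r holomorphic_on S"
  using fib_iter_holomorphic holomorphic_on_subset by blast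

lemma fib_iter_continuous: "continuous_on S (fib_iter d p r)"
  using fib_iter_holomorphic_on holomorphic_on_imp_continuous_on by blast

lemma closed_filled_julia:
  assumes "params d p"
  shows "closed (filled_julia d p)"
proof -
  have "filled_julia d p = {z. \<forall>r. cmod (fib_iter d p r z) \<le> 1}"
    using filled_julia_iff[OF assms] by blast
  then show ?thesis
    by (simp only:) (intro closed_Collect_all closed_Collect_le continuous_intros fib_iter_continuous)
qed

lemma frontier_filled_julia:
  "params d p \<Longrightarrow> frontier (filled_julia d p) = filled_julia d p - interior (filled_julia d p)"
  by (simp add: frontier_def closed_filled_julia)

lemma fib_map_fix_1: "params d p \<Longrightarrow> r \<ge> 1 \<Longrightarrow> fib_map d p r 1 = 1"
  using paramsD(2)[of d p r] by (simp add: fib_map_def)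

lemma fib_iter_one_mono:
  "params d p \<Longrightarrow> fib_iter d p r z = 1 \<Longrightarrow> fib_iter d p (r + k) z = 1"
  by (induction k) (simp_all add: fib_map_fix_1)

lemma fib_iter_open_map:
  assumes "params d p" "open U"
  shows "open (fib_iter d p r ` U)"
proof (rule open_mapping_thm[OF fib_iter_holomorphic open_UNIV connected_UNIV assms(2) subset_UNIV])
  show "\<not> fib_iter d p r constant_on UNIV"
  proof
    assume "fib_iter d p r constant_on UNIV"
    \<comment> \<open>The iterate is not constant because 1 is fixed while the orbit of 2
      escapes.\<close>
    then have "fib_iter d p r 2 = fib_iter d p r 1" by (auto simp: constant_on_def)
    moreover have "fib_iter d p r 1 = 1" using fib_iter_one_mono[OF assms(1), of 0 1 r] by simp
    moreover have "2 ^ Suc r \<le> cmod (fib_iter d p r 2)"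
      using fib_iter_growth[OF assms(1), of 2 0 2 r] by simp
    moreover have "(1::real) \<le> 2 ^ r" by simp
    ultimately show False by simp
  qed
qed

text \<open>The orbit stays at 1 from \<open>m\<close> on, hence is bounded. Were the point
  interior, the open iterate \<open>fib_iter d p m\<close> would take values of modulus above 1 on
  the Julia set.\<close>

lemma preimage_in_frontier:
  assumes "params d p" "fib_iter d p m z = 1"
  shows "z \<in> frontier (filled_julia d p)"
proof -
  have "cmod (fib_iter d p r z) \<le> 1" for r
  proof (rule ccontr)
    assume "\<not> cmod (fib_iter d p r z) \<le> 1"
    then obtain k where "k \<ge> m" "1 < cmod (fib_iter d p k z)"
      using fib_iter_escape[OF assms(1), of r z m 1] by auto
    then show False using fib_iter_one_mono[OF assms, of "k - m"] by simp
  qed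
  then have "z \<in> filled_julia d p" using filled_julia_iff[OF assms(1)] by blast
  moreover have "z \<notin> interior (filled_julia d p)"
  proof
    let ?U = "fib_iter d p m ` interior (filled_julia d p)"
    assume "z \<in> interior (filled_julia d p)"
    then have "1 \<in> ?U" using assms(2) by (metis imageI)
    moreover have "open ?U" by (rule fib_iter_open_map[OF assms(1) open_interior])
    ultimately obtain e where e: "e > 0" "ball 1 e \<subseteq> ?U" by (meson open_contains_ball)
    have "1 + of_real (e / 2) \<in> ball (1 :: complex) e" using e(1) by (simp add: dist_norm)
    then have "1 + of_real (e / 2) \<in> ?U" using e(2) by blast
    then obtain y where y: "1 + of_real (e / 2) = fib_iter d p m y" "y \<in> interior (filled_julia d p)"
      by (rule imageE)
    have "y \<in> filled_julia d p" using y(2) interior_subset by blast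
    then have "cmod (1 + of_real (e / 2)) \<le> 1"
      unfolding y(1) using filled_julia_iff[OF assms(1)] by blast
    moreover have "1 + of_real (e / 2) = complex_of_real (1 + e / 2)" by simp
    then have "cmod (1 + of_real (e / 2)) = 1 + e / 2"
      using e(1) by (simp only: norm_of_real)
    ultimately show False using e(1) by simp
  qed
  ultimately show ?thesis using frontier_filled_julia[OF assms(1)] by blast
qed

text \<open>The root of index n div 2 has an argument between pi/2 and pi, hence a real part of at
  most 0. The lower bound is independent of \<open>n\<close>, as the normalisation before Schottky's
  theorem requires.\<close>

lemma root_of_unity_far:
  assumes "n \<ge> (2::nat)"
  shows "\<exists>\<zeta>. \<zeta> ^ n = 1 \<and> 1 \<le> cmod (\<zeta> - 1) \<and> cmod (\<zeta> - 1) \<le> 2"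
proof -
  define k where "k = n div 2"
  define \<theta> where "\<theta> = 2 * pi * real k / real n"
  have "real n \<le> 4 * real k" "2 * real k \<le> real n"
    using assms by (auto simp: k_def)
  then have "pi / 2 \<le> \<theta>" "\<theta> \<le> pi"
    using assms pi_gt_zero by (simp_all add: \<theta>_def field_simps)
  then have cos: "cos \<theta> \<le> 0" using cos_monotone_0_pi_le[of "pi / 2" \<theta>] by simp
  have "cis \<theta> ^ n = cis (real n * \<theta>)" by (rule Complex.DeMoivre)
  also have "real n * \<theta> = 2 * pi * real k" using assms by (simp add: \<theta>_def)
  finally have "cis \<theta> ^ n = 1" by (simp add: cis_multiple_2pi)
  moreover have "1 \<le> cmod (cis \<theta> - 1)"
    using abs_Re_le_cmod[of "cis \<theta> - 1"] cos by simp
  moreover have "cmod (cis \<theta> - 1) \<le> 2" using norm_triangle_ineq4[of "cis \<theta>" 1] by simp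
  ultimately show ?thesis by blast
qed

text \<open>
  Away from the preimages of \<open>1\<close> the iterate \<open>fib_iter d p r\<close> omits the two values \<open>1\<close> and
  \<open>1 - p\<^sub>r\<^sub>+\<^sub>1 + p\<^sub>r\<^sub>+\<^sub>1 \<zeta>\<close>, so by Schottky's theorem it cannot be bounded at one point and
  arbitrarily large at a nearby one.
\<close>

lemma frontier_subset_closure_preimages:
  assumes "params d p" "z0 \<in> frontier (filled_julia d p)"
  shows "z0 \<in> closure (\<Union>r\<in>{1..}. fib_iter d p r -` {1})"
proof (rule ccontr)
  assume "z0 \<notin> closure (\<Union>r\<in>{1..}. fib_iter d p r -` {1})"
  then obtain e where e: "e > 0" "\<And>y r. r \<ge> 1 \<Longrightarrow> fib_iter d p r y = 1 \<Longrightarrow> e \<le> dist y z0"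
    unfolding closure_approachable by (force simp: not_less)
  \<comment> \<open>This includes \<open>r = 0\<close>: since 1 is fixed, w_r = 1 would give w_(r+1)
    = 1.\<close>
  have not1: "fib_iter d p r y \<noteq> 1" if "dist y z0 < e" for r y
    using e(2)[of "Suc r" y] fib_iter_one_mono[OF assms(1), of r y 1] that by force
  have z0: "z0 \<in> filled_julia d p" "z0 \<notin> interior (filled_julia d p)"
    using assms(2) frontier_filled_julia[OF assms(1)] by auto
  \<comment> \<open>The closed disc of radius \<rho>, on which \<open>Schottky\<close> is applied,
    must lie inside the open disc of radius \<open>e\<close>.\<close>
  define \<rho> where "\<rho> = e / 2"
  have \<rho>: "\<rho> > 0" "\<rho> < e" using e(1) by (auto simp: \<rho>_def)
  obtain z1 where z1: "dist z1 z0 < \<rho> / 2" "z1 \<notin> filled_julia d p"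
    using z0(2) half_gt_zero[OF \<rho>(1)] unfolding mem_interior by (metis dist_commute mem_ball subsetI)
  define t1 where "t1 = (z1 - z0) / of_real \<rho>"
  have t1: "cmod t1 \<le> 1 / 2" "z0 + of_real \<rho> * t1 = z1"
    using z1(1) \<rho>(1) by (auto simp: t1_def norm_divide dist_norm field_simps)
  \<comment> \<open>The bound of \<open>Schottky\<close> for |F 0| at most 2 and |t| at most 1/2. It
    does not depend on the iterate, so \<open>r\<close> can be chosen after
    \<open>C\<close>.\<close>
  define C where "C = exp (pi * exp (pi * (2 + 2 * 2 + 12 * (1 / 2) / (1 - 1 / 2))))"
  obtain r where r: "1 + 2 * C < cmod (fib_iter d p r z1)"
    using z1(2) filled_julia_iff[OF assms(1)] fib_iter_escape[OF assms(1)] by (meson not_le)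
  define q where "q = p (Suc r)"
  have q: "0 < q" "q \<le> 1" using paramsD[OF assms(1), of "Suc r"] by (auto simp: q_def)
  obtain \<zeta> where \<zeta>: "\<zeta> ^ d (Suc r) = 1" "1 \<le> cmod (\<zeta> - 1)" "cmod (\<zeta> - 1) \<le> 2"
    using root_of_unity_far paramsD(1)[OF assms(1), of "Suc r"] by auto
  define c where "c = of_real q * (\<zeta> - 1)"
  have c: "c \<noteq> 0" using q \<zeta>(2) by (auto simp: c_def)
  \<comment> \<open>Normalised so that the omitted values become 0 and 1: F = 0 means w_r = 1, and F
    = 1 means w_r = 1 - q + q \<zeta>, which the next map sends to \<zeta>^d_(r+1) = 1.\<close>
  define F where "F t = (fib_iter d p r (z0 + of_real \<rho> * t) - 1) * inverse c" for t
  have wF: "fib_iter d p r (z0 + of_real \<rho> * t) - 1 = c * F t" for t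
    using c by (simp add: F_def)
  have next_iter: "fib_iter d p (Suc r) (z0 + of_real \<rho> * t) = (1 + (\<zeta> - 1) * F t) ^ d (Suc r)" for t
  proof -
    have "fib_iter d p r (z0 + of_real \<rho> * t) - of_real (1 - q) = of_real q * (1 + (\<zeta> - 1) * F t)"
      using wF[of t] by (simp add: c_def algebra_simps)
    then show ?thesis using q by (simp add: fib_map_def flip: q_def)
  qed
  have "cmod (F t1) \<le> C"
    unfolding C_def
  proof (rule Schottky[where f = F])
    have "(fib_iter d p r \<circ> (\<lambda>t. z0 + of_real \<rho> * t)) holomorphic_on cball 0 1"
      by (intro holomorphic_on_compose_gen[OF _ fib_iter_holomorphic] holomorphic_intros) auto
    then show "F holomorphic_on cball 0 1"
      unfolding F_def o_def by (intro holomorphic_intros)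
    \<comment> \<open>The bound on w_r alone would only give |F 0| at most 2 / q up to a constant,
      with no lower bound for q. The bound on w_(r+1) puts 1 + (\<zeta> - 1) F 0 into the closed
      unit disc, and q disappears.\<close>
    have "cmod (1 + (\<zeta> - 1) * F 0) ^ d (Suc r) \<le> 1"
      using z0(1) filled_julia_iff[OF assms(1), of z0] next_iter[of 0] by (metis norm_power add.right_neutral mult_zero_right)
    then have "cmod (1 + (\<zeta> - 1) * F 0) \<le> 1"
      using paramsD(1)[OF assms(1), of "Suc r"] by (simp add: power_le_one_iff)
    then have "cmod ((\<zeta> - 1) * F 0) \<le> 2"
      using norm_triangle_ineq4[of "1 + (\<zeta> - 1) * F 0" 1] by simp
    then show "cmod (F 0) \<le> 2"
      using mult_right_mono[OF \<zeta>(2) norm_ge_zero[of "F 0"]] by (simp add: norm_mult)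
    fix t :: complex assume "t \<in> cball 0 1"
    then have "\<rho> * cmod t \<le> \<rho> * 1" using \<rho>(1) by (intro mult_left_mono) auto
    then have "\<rho> * cmod t < e" using \<rho>(2) by linarith
    then have near: "dist (z0 + of_real \<rho> * t) z0 < e" using \<rho>(1) by (simp add: dist_norm norm_mult)
    have "F t \<noteq> 0" using not1[OF near, of r] wF[of t] by auto
    moreover have "F t \<noteq> 1" using not1[OF near, of "Suc r"] next_iter[of t] \<zeta>(1) by auto
    ultimately show "\<not> (F t = 0 \<or> F t = 1)" by blast
  qed (use t1 in auto)
  moreover have "cmod c \<le> 2"
    using mult_mono[OF q(2) \<zeta>(3)] q(1) by (simp add: c_def norm_mult)
  ultimately have "cmod (c * F t1) \<le> 2 * C" unfolding norm_mult by (intro mult_mono) auto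
  then have "cmod (fib_iter d p r z1 - 1) \<le> 2 * C" using wF[of t1] t1(2) by simp
  then show False using r norm_triangle_ineq2[of "fib_iter d p r z1" 1] by simp
qed

lemma closure_preimages:
  assumes "params d p"
  shows "closure (\<Union>r\<in>{1..}. fib_iter d p r -` {1}) = frontier (filled_julia d p)"
proof
  have "(\<Union>r\<in>{1..}. fib_iter d p r -` {1}) \<subseteq> frontier (filled_julia d p)"
    using preimage_in_frontier[OF assms] by auto
  then show "closure (\<Union>r\<in>{1..}. fib_iter d p r -` {1}) \<subseteq> frontier (filled_julia d p)"
    by (rule closure_minimal) (rule frontier_closed)
  show "frontier (filled_julia d p) \<subseteq> closure (\<Union>r\<in>{1..}. fib_iter d p r -` {1})"
    using frontier_subset_closure_preimages[OF assms] by blast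
qed

section \<open>Orbits of interior points\<close>

lemma fib_iter_add:
  "fib_iter d p (r + k) z = fib_iter ((shift ^^ r) d) ((shift ^^ r) p) k (fib_iter d p r z)"
  by (induction k) (simp_all add: fib_map_def shift_funpow add.commute del: shift_apply)

lemma interior_filled_julia_shift:
  assumes "params d p" "l \<in> interior (filled_julia d p)"
  shows "fib_iter d p r l \<in> interior (filled_julia ((shift ^^ r) d) ((shift ^^ r) p))"
proof (rule interiorI)
  show "open (fib_iter d p r ` interior (filled_julia d p))"
    by (rule fib_iter_open_map[OF assms(1) open_interior])
  show "fib_iter d p r l \<in> fib_iter d p r ` interior (filled_julia d p)" using assms(2) by blast
  show "fib_iter d p r ` interior (filled_julia d p) \<subseteq> filled_julia ((shift ^^ r) d) ((shift ^^ r) p)"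
    using interior_subset[of "filled_julia d p"]
    by (auto simp: filled_julia_iff[OF assms(1)] filled_julia_iff[OF params_funpow[OF assms(1)]]
        simp flip: fib_iter_add)
qed

text \<open>Otherwise the derivatives of the iterates would grow, against Cauchy's inequality.\<close>

lemma interior_orbit_small:
  assumes "params d p" "l \<in> interior (filled_julia d p)"
  shows "\<exists>r. cmod (fib_iter d p r l) < 3 / 4"
proof (rule ccontr)
  assume "\<nexists>r. cmod (fib_iter d p r l) < 3 / 4"
  then have big: "3 / 4 \<le> cmod (fib_iter d p r l)" for r by (simp add: not_less)
  obtain \<rho> where \<rho>: "\<rho> > 0" "cball l \<rho> \<subseteq> filled_julia d p"
    using assms(2) mem_interior_cball by blast
  then have le1: "cmod (fib_iter d p r z) \<le> 1" if "z \<in> cball l \<rho>" for r z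
    using filled_julia_iff[OF assms(1)] that by blast
  \<comment> \<open>The next map contributes the factor n i^(n-1) / q to the derivative. Here |i| <=
    1 gives |i|^(n-1) >= |i|^n = |w_(r+1)| >= 3/4, so with n >= 2 and q <= 1 the factor is at least
    3/2 in modulus.\<close>
  have grow: "\<exists>D. (fib_iter d p r has_field_derivative D) (at l) \<and> (3 / 2) ^ r \<le> cmod D" for r
  proof (induction r)
    case 0
    have "(fib_iter d p 0 has_field_derivative 1) (at l)"
      unfolding fib_iter.simps(1)[abs_def] by (rule DERIV_ident)
    then show ?case by (intro exI[of _ 1]) simp
  next
    case (Suc r)
    then obtain D where D: "(fib_iter d p r has_field_derivative D) (at l)" "(3 / 2) ^ r \<le> cmod D" by blast
    define q n where "q = p (Suc r)" and "n = d (Suc r)"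
    have q: "0 < q" "q \<le> 1" "2 \<le> n" using paramsD[OF assms(1), of "Suc r"] by (auto simp: q_def n_def)
    define i where "i = (fib_iter d p r l - of_real (1 - q)) / of_real q"
    have "((\<lambda>z. (fib_iter d p r z - of_real (1 - q)) / of_real q) has_field_derivative
        (D - 0) / of_real q) (at l)"
      by (intro DERIV_cdivide DERIV_diff D(1) DERIV_const)
    from DERIV_power[OF this, of n]
    have "((\<lambda>z. ((fib_iter d p r z - of_real (1 - q)) / of_real q) ^ n) has_field_derivative
        of_nat n * i ^ (n - 1) * (D / of_real q)) (at l)"
      by (simp add: i_def mult_ac)
    then have der: "(fib_iter d p (Suc r) has_field_derivative of_nat n * i ^ (n - 1) * (D / of_real q)) (at l)"
      unfolding fib_iter.simps(2)[abs_def] fib_map_def q_def n_def .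
    have "fib_iter d p (Suc r) l = i ^ n" by (simp add: fib_map_def i_def q_def n_def)
    then have in1: "3 / 4 \<le> cmod i ^ n" "cmod i ^ n \<le> 1"
      using big[of "Suc r"] le1[of l "Suc r"] \<rho>(1) by (simp_all add: norm_power)
    then have "cmod i \<le> 1" using q by (simp add: power_le_one_iff)
    then have "cmod i ^ n \<le> cmod i ^ (n - 1)" by (intro power_decreasing) auto
    then have i: "3 / 4 \<le> cmod i ^ (n - 1)" using in1 by simp
    have "q * cmod D \<le> 1 * cmod D" using q by (intro mult_right_mono) auto
    then have Dq: "cmod D \<le> cmod D / q" using q by (simp add: field_simps)
    have "(3 / 2) ^ Suc r \<le> (2 * (3 / 4)) * cmod D" using D(2) by simp
    also have "\<dots> \<le> (real n * cmod i ^ (n - 1)) * (cmod D / q)"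
      using q i Dq by (intro mult_mono) auto
    also have "\<dots> = cmod (of_nat n * i ^ (n - 1) * (D / of_real q))"
      using q by (simp add: norm_mult norm_power norm_divide)
    finally show ?case using der by blast
  qed
  have "(3 / 2) ^ r \<le> 1 / \<rho>" for r
  proof -
    obtain D where D: "(fib_iter d p r has_field_derivative D) (at l)" "(3 / 2) ^ r \<le> cmod D"
      using grow by blast
    \<comment> \<open>All iterates are bounded by 1 on the disc of radius \<rho>, so their
      derivatives at \<open>l\<close> have the common bound 1 / \<rho>.\<close>
    have "norm ((deriv ^^ 1) (fib_iter d p r) l) \<le> fact 1 * 1 / \<rho> ^ 1"
      by (rule Cauchy_inequality[OF fib_iter_holomorphic_on fib_iter_continuous \<rho>(1)])
         (auto intro!: le1 simp: dist_norm)
    then show ?thesis using D DERIV_imp_deriv[OF D(1)] by simp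
  qed
  moreover obtain r where "1 / \<rho> < (3 / 2) ^ r" using real_arch_pow[of "3 / 2" "1 / \<rho>"] by auto
  ultimately show False by (meson not_le)
qed

section \<open>The spectrum\<close>

lemma inf_prod_funpow:
  "params d p \<Longrightarrow> inf_prod p = pprod p r * inf_prod ((shift ^^ r) p)"
proof (induction r arbitrary: d p)
  case (Suc r)
  show ?case
    unfolding funpow_Suc_right o_apply pprod_shift inf_prod_shift[OF Suc.prems]
    using Suc.IH[OF params_shift[OF Suc.prems]] by (simp only: mult.assoc)
qed simp

lemma spectrum_subset_filled_julia:
  assumes "params d p"
  shows "spectrum_on (C_Gamma d) (sup_norm d) (S_op d p) \<subseteq> filled_julia d p"
proof (rule subsetI, rule ccontr)
  fix l assume l: "l \<in> spectrum_on (C_Gamma d) (sup_norm d) (S_op d p)" "l \<notin> filled_julia d p"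
  then obtain r where "1 < cmod (fib_iter d p r l)"
    using filled_julia_iff[OF assms] by (auto simp: not_le)
  then have "invertible_at d p l"
    by (intro invertible_at_iter[OF assms, of r] invertible_at_large params_funpow[OF assms])
  then show False using invertible_at_not_spectrum[OF assms] l by blast
qed

lemma interior_not_spectrum:
  assumes "params d p" "inf_prod p > 0" "l \<in> interior (filled_julia d p)"
  shows "l \<notin> spectrum_on (C_Gamma d) (sup_norm d) (S_op d p)"
proof -
  have "\<forall>\<^sub>F r in sequentially. pprod p r < 8 / 7 * inf_prod p"
    using pprod_tendsto[OF assms(1)] assms(2) by (intro order_tendstoD(2)) auto
  \<comment> \<open>The infinite product is \<open>pprod p k\<close> times the tail product after
    \<open>k\<close>, so the factor 8/7 says that this tail exceeds 7/8; the defect of the shifted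
    operator is then below 1/4.\<close>
  then obtain r where r: "\<And>k. k \<ge> r \<Longrightarrow> pprod p k < 8 / 7 * inf_prod p"
    by (auto simp: eventually_sequentially)
  let ?d = "(shift ^^ r) d" and ?p = "(shift ^^ r) p"
  \<comment> \<open>The small orbit point must come at or after index \<open>r\<close>, so
    \<open>interior_orbit_small\<close> is applied to the parameters shifted by
    \<open>r\<close>.\<close>
  obtain k where k: "cmod (fib_iter ?d ?p k (fib_iter d p r l)) < 3 / 4"
    using interior_orbit_small[OF params_funpow[OF assms(1)] interior_filled_julia_shift[OF assms(1,3)]]
    by blast
  let ?I = "inf_prod ((shift ^^ (r + k)) p)"
  have "pprod p (r + k) * (7 / 8) < pprod p (r + k) * ?I"
    using r[of "r + k"] inf_prod_funpow[OF assms(1), of "r + k"] by simp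
  then have "7 / 8 < ?I" using pprod_pos[OF assms(1)] by simp
  moreover have "cmod (fib_iter d p (r + k) l) < 3 / 4" using k by (simp only: fib_iter_add)
  ultimately have "cmod (fib_iter d p (r + k) l) + 2 * (1 - ?I) < 1" by simp
  then have "invertible_at d p l"
    by (intro invertible_at_iter[OF assms(1), of "r + k"] invertible_at_small params_funpow[OF assms(1)])
  then show ?thesis by (rule invertible_at_not_spectrum[OF assms(1)])
qed

theorem theorem4p1:
  fixes d :: "nat \<Rightarrow> nat" and p :: "nat \<Rightarrow> real"
  assumes "\<And>r. r \<ge> 1 \<Longrightarrow> d r \<ge> 2"
    and "\<And>r. r \<ge> 1 \<Longrightarrow> 0 < p r \<and> p r \<le> 1"
    and "bdd_above (d ` {1..})"
  shows
    "spectrum_on (C_Gamma d) (sup_norm d) (S_op d p)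
       = approx_spectrum_on (C_Gamma d) (sup_norm d) (S_op d p)
     \<and> (inf_prod p = 0 \<longrightarrow>
          approx_spectrum_on (C_Gamma d) (sup_norm d) (S_op d p) = filled_julia d p)
     \<and> (inf_prod p > 0 \<longrightarrow>
          approx_spectrum_on (C_Gamma d) (sup_norm d) (S_op d p) = frontier (filled_julia d p))
     \<and> point_spectrum_on (C_Gamma d) (S_op d p) = (\<Union>r\<in>{1..}. fib_iter d p r -` {1})
     \<and> closure (\<Union>r\<in>{1..}. fib_iter d p r -` {1}) = frontier (filled_julia d p)"
proof -
  have par: "params d p" using assms(1,2) by (simp add: params_def)
  let ?\<sigma> = "spectrum_on (C_Gamma d) (sup_norm d) (S_op d p)"
  let ?a = "approx_spectrum_on (C_Gamma d) (sup_norm d) (S_op d p)"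
  let ?E = "filled_julia d p"
  have a\<sigma>: "?a \<subseteq> ?\<sigma>" by (rule approx_spectrum_subset_spectrum[OF par])
  have \<sigma>E: "?\<sigma> \<subseteq> ?E" by (rule spectrum_subset_filled_julia[OF par])
  have fa: "frontier ?E \<subseteq> ?a"
    using closure_preimages_approx_spectrum[OF par] closure_preimages[OF par] by blast
  have zero: "?a = ?E \<and> ?\<sigma> = ?a" if "inf_prod p = 0"
  proof -
    have "?E \<subseteq> ?a"
      using approx_spectrum_of_vanishing_product[OF par that] filled_julia_iff[OF par] by blast
    then show ?thesis using a\<sigma> \<sigma>E by blast
  qed
  have pos: "?a = frontier ?E \<and> ?\<sigma> = ?a" if "inf_prod p > 0"
  proof -
    have "?\<sigma> \<subseteq> frontier ?E"
      using \<sigma>E interior_not_spectrum[OF par that] frontier_filled_julia[OF par] by blast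
    then show ?thesis using a\<sigma> fa by blast
  qed
  have "?\<sigma> = ?a" using zero pos inf_prod_nonneg[OF par] by (cases "inf_prod p = 0") auto
  then show ?thesis using zero pos point_spectrum_eq[OF par] closure_preimages[OF par] by blast
qed

end
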